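(* Let $P \subseteq \mathbb{R}^d$ be a $d$-dimensional polytope with vertices in $\mathbb{Z}^d$ such that $P' := \operatorname{conv}(\operatorname{int}(P)\cap\mathbb{Z}^d) \ne \emptyset$. Then \[ \operatorname{ld}(P) \le (\operatorname{ld}(P') + 2)(s_d - 1), \] with equality if and only if $P$ is unimodularly equivalent to $S^d_k$ for some $k \in \mathbb{N}$.
   Context: The Sylvester sequence: $s_1 = 2$, $s_i = \prod_{j=1}^{i-1} s_j + 1$ for $i\ge2$. The lattice diameter $\operatorname{ld}(P)$ of a polyhedron $P$ is the maximum of $|P\cap\mathbb{Z}^d\cap g| - 1$ over all rational lines $g$ (and $\operatorname{ld}(\emptyset)=-1$). For $d\ge 2$, $k \ge 0$: $S^d_k := \operatorname{conv}(\{0, s_1e_1, \ldots, s_{d-1}e_{d-1}, (k+1)(s_d-1)e_d\})$. Unimodular equivalence: existence of an affine bijection of $\mathbb{R}^d$ preserving $\mathbb{Z}^d$ mapping one onto the other. *)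

theory Defs
  imports "HOL-Analysis.Analysis"
begin

text \<open>Sylvester sequence: sylv n = (prod_{j=1}^{n-1} sylv j) + 1; so sylv 1 = 2
  (sylv 0 = 1 is an irrelevant by-product).\<close>
function sylv :: "nat \<Rightarrow> nat" where
  "sylv n = (\<Prod>j\<in>{1..<n}. sylv j) + 1"
  by auto
termination
  by (relation "Wellfounded.measure id") auto

definition lattice :: "(real^'n) set" where
  "lattice = {x. \<forall>i. x $ i \<in> \<int>}"

definition rational_line :: "(real^'n) set \<Rightarrow> bool" where
  "rational_line g \<longleftrightarrow> (\<exists>p q. (\<forall>i. p $ i \<in> \<rat>) \<and> (\<forall>i. q $ i \<in> \<rat>) \<and> p \<noteq> q
                              \<and> g = affine hull {p, q})"

definition ld :: "(real^'n) set \<Rightarrow> int" where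
  "ld P = Max {int (card (P \<inter> lattice \<inter> g)) - 1 | g. rational_line g}"

definition unimod_equiv :: "(real^'n) set \<Rightarrow> (real^'n) set \<Rightarrow> bool" where
  "unimod_equiv P Q \<longleftrightarrow> (\<exists>f g b. linear g \<and> f = (\<lambda>x. g x + b) \<and> bij f
        \<and> f ` lattice = lattice \<and> f ` P = Q)"

text \<open>The simplex S^d_k, with coordinates 1..d enumerated by the bijection sigma.\<close>
definition simplexS :: "(nat \<Rightarrow> 'n::finite) \<Rightarrow> nat \<Rightarrow> (real^'n) set" where
  "simplexS \<sigma> k = convex hull
     ({0} \<union> {real (sylv i) *\<^sub>R axis (\<sigma> i) 1 | i. i \<in> {1..<CARD('n)}}
          \<union> {real ((k + 1) * (sylv CARD('n) - 1)) *\<^sub>R axis (\<sigma> CARD('n)) 1})"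

end

theory Submission
  imports Defs "HOL-Number_Theory.Cong"
begin

text \<open>
  Let \<open>[a, a + L u]\<close>, with \<open>u\<close> primitive, be a longest lattice segment in \<open>P\<close>, and let \<open>K = ld P' + 2\<close>.
  A line parallel to \<open>u\<close> carries fewer than \<open>K\<close> interior lattice points, so if it contains a lattice point
  and meets the interior of \<open>P\<close>, then it meets \<open>P\<close> in a segment of length at most \<open>K\<close>. Modulo \<open>u\<close>, some interior lattice
  point lies in the relative interior of a simplex with apex \<open>a\<close> and \<open>r \<le> d - 1\<close> further vertices of \<open>P\<close>.
  Choose a lattice point in the relative interior of this simplex whose weight \<open>w\<close> at \<open>a\<close> is nearly maximal.
  The segment through it has length at least \<open>w L\<close>, whence \<open>w L \<le> K\<close>. By a pigeonhole
  (Minkowski) argument, its other weights satisfy \<open>\<Prod>\<beta> \<le> 1 - \<Sum>\<beta>\<close> over every subset of the vertices,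
  which forces \<open>w \<ge> 1 / (s\<^bsub>r+1\<^esub> - 1)\<close> with equality only for \<open>\<beta>\<^sub>i = 1 / s\<^sub>i\<close>.

  In the case of equality, maximality of \<open>w\<close> determines the lattice: it is generated by \<open>u\<close> and the edges
  from \<open>a\<close> divided by the \<open>s\<^sub>i\<close>. Any further point of \<open>P\<close> would make some segment longer than \<open>K\<close>.
\<close>

section \<open>Sylvester sequence and extremal sums\<close>

declare sylv.simps [simp del]

lemma sylv_minus_one: "sylv n - 1 = (\<Prod>j\<in>{1..<n}. sylv j)"
  by (simp add: sylv.simps[of n])

lemma sylv_pos: "sylv n > 0"
  by (simp add: sylv.simps[of n])

lemma sylv_ge2: "n \<ge> 1 \<Longrightarrow> sylv n \<ge> 2"
proof -
  have "(\<Prod>j\<in>{1..<n}. sylv j) > 0"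
    by (rule prod_pos) (simp add: sylv_pos)
  then show ?thesis unfolding sylv.simps[of n] by linarith
qed

lemma sylv_strict_mono:
  assumes "1 \<le> m" "m < n"
  shows "sylv m < sylv n"
proof -
  have "sylv m dvd (\<Prod>j\<in>{1..<n}. sylv j)"
    using assms by (intro dvd_prodI) auto
  moreover have "(\<Prod>j\<in>{1..<n}. sylv j) > 0"
    by (rule prod_pos) (simp add: sylv_pos)
  ultimately have "sylv m \<le> (\<Prod>j\<in>{1..<n}. sylv j)"
    by (rule dvd_imp_le)
  then show ?thesis unfolding sylv.simps[of n] by linarith
qed

lemma coprime_sylv:
  assumes "1 \<le> m" "1 \<le> n" "m \<noteq> n"
  shows "coprime (sylv m) (sylv n)"
proof -
  have *: "coprime (sylv m) (sylv n)" if "1 \<le> m" "m < n" for m n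
  proof -
    have "sylv m dvd (\<Prod>j\<in>{1..<n}. sylv j)"
      using that by (intro dvd_prodI) auto
    then obtain c where "sylv n = sylv m * c + 1"
      by (auto simp: sylv.simps[of n])
    then show ?thesis
      by (metis coprime_1_right coprime_add_one_right coprime_mult_left_iff coprime_commute)
  qed
  show ?thesis
    using *[of m n] *[of n m] assms by (metis coprime_commute linorder_neqE_nat)
qed

text \<open>\<open>sylv (Suc r)\<close> exceeds the product p of its predecessors by one, and 1/p -
  1/(p+1) = 1/(p(p+1)). So the gap between the partial sum and 1 is always the product of the
  reciprocals.\<close>

lemma sum_inverse_sylv:
  "(\<Sum>i\<in>{1..r}. 1 / real (sylv i)) = 1 - (\<Prod>i\<in>{1..r}. 1 / real (sylv i))"
proof (induction r)
  case (Suc r)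
  define p where "p = (\<Prod>i\<in>{1..r}. real (sylv i))"
  have p: "p > 0" unfolding p_def by (rule prod_pos) (simp add: sylv_pos)
  have s: "real (sylv (Suc r)) = p + 1"
    unfolding p_def using sylv.simps[of "Suc r"] by (simp add: atLeastLessThanSuc_atLeastAtMost)
  have q: "(\<Prod>i\<in>{1..r}. 1 / real (sylv i)) = 1 / p"
    by (simp add: p_def prod_dividef)
  have "(\<Sum>i\<in>{1..Suc r}. 1 / real (sylv i)) = 1 - 1 / p + 1 / (p + 1)"
    using Suc unfolding q by (simp add: s)
  also have "\<dots> = 1 - 1 / p * (1 / (p + 1))"
    using p by (simp add: divide_simps) (simp add: algebra_simps)?
  also have "\<dots> = 1 - (\<Prod>i\<in>{1..Suc r}. 1 / real (sylv i))"
    unfolding q[symmetric] s[symmetric] by simp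
  finally show ?case .
qed simp

lemma prod_inverse_sylv:
  "(\<Prod>i\<in>{1..r}. 1 / real (sylv i)) = 1 / (real (sylv (Suc r)) - 1)"
  using sylv.simps[of "Suc r"] by (simp add: prod_dividef atLeastLessThanSuc_atLeastAtMost)

text \<open>Abel summation: since \<open>c\<close> increases and every tail sum of \<open>g\<close>
  is nonnegative, replacing \<open>c t\<close> by \<open>c (Suc t)\<close> on the tail after
  \<open>t\<close> cannot decrease the value. The induction runs downwards from
  \<open>t = r\<close>.\<close>

lemma sum_mult_ge_of_tails:
  fixes c g :: "nat \<Rightarrow> real"
  assumes "t \<le> r"
    and "\<And>i j. t \<le> i \<Longrightarrow> i \<le> j \<Longrightarrow> j \<le> r \<Longrightarrow> c i \<le> c j"
    and "\<And>i. t \<le> i \<Longrightarrow> i \<le> r \<Longrightarrow> 0 \<le> (\<Sum>j\<in>{i..r}. g j)"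
  shows "c t * (\<Sum>j\<in>{t..r}. g j) \<le> (\<Sum>j\<in>{t..r}. c j * g j)"
  using assms
proof (induction rule: inc_induct)
  case (step t)
  have "c t * (\<Sum>j\<in>{Suc t..r}. g j) \<le> c (Suc t) * (\<Sum>j\<in>{Suc t..r}. g j)"
    using step by (intro mult_right_mono) auto
  also have "\<dots> \<le> (\<Sum>j\<in>{Suc t..r}. c j * g j)"
    using step by simp
  finally show ?case
    using step.hyps by (simp add: sum.atLeast_Suc_atMost[of t r] algebra_simps)
qed simp

text \<open>Soundararajan's argument: if the sum reaches that of the reciprocals, then the tails dominate,
  so by Abel summation and \<open>ln x \<le> x - 1\<close> the product dominates as well, which the
  hypothesis for \<open>t = r\<close> only permits in the case of equality.\<close>
lemma sum_le_sum_inverse_sylv: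
  fixes x :: "nat \<Rightarrow> real"
  assumes pos: "\<And>i. i \<in> {1..r} \<Longrightarrow> 0 < x i"
    and anti: "\<And>i j. 1 \<le> i \<Longrightarrow> i \<le> j \<Longrightarrow> j \<le> r \<Longrightarrow> x j \<le> x i"
    and prod_le: "\<And>t. t \<in> {1..r} \<Longrightarrow> (\<Prod>i\<in>{1..t}. x i) \<le> 1 - (\<Sum>i\<in>{1..t}. x i)"
  shows "(\<Sum>i\<in>{1..r}. x i) \<le> (\<Sum>i\<in>{1..r}. 1 / real (sylv i))
    \<and> ((\<Sum>i\<in>{1..r}. x i) = (\<Sum>i\<in>{1..r}. 1 / real (sylv i)) \<longrightarrow> (\<forall>i\<in>{1..r}. x i = 1 / real (sylv i)))"
  using assms
proof (induction r rule: less_induct)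
  case (less r)
  define y where "y = (\<lambda>i. 1 / real (sylv i))"
  have ypos: "0 < y i" for i
    by (simp add: y_def sylv_pos)
  have eq: "\<forall>i\<in>{1..r}. x i = y i" if ge: "(\<Sum>i\<in>{1..r}. y i) \<le> (\<Sum>i\<in>{1..r}. x i)"
  proof (cases "r = 0")
    case False
    \<comment> \<open>By the induction hypothesis the first i - 1 terms of \<open>x\<close> sum to
      at most those of \<open>y\<close>. The later terms must make up for this, as the full sum of
      \<open>x\<close> is not smaller.\<close>
    have tail: "0 \<le> (\<Sum>j\<in>{i..r}. x j - y j)" if i: "1 \<le> i" "i \<le> r" for i
    proof -
      have "(\<Sum>j\<in>{1..i-1}. x j) \<le> (\<Sum>j\<in>{1..i-1}. y j)"
        unfolding y_def using i by (intro conjunct1[OF less.IH] less.prems) auto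
      moreover have "(\<Sum>j\<in>{1..r}. f j) = (\<Sum>j\<in>{1..i-1}. f j) + (\<Sum>j\<in>{i..r}. f j)" for f :: "nat \<Rightarrow> real"
        using i sum.ub_add_nat[of 1 "i-1" f "r - (i-1)"] by simp
      ultimately show ?thesis
        using ge by (simp add: sum_subtractf)
    qed
    have "0 \<le> 1 / x 1 * (\<Sum>j\<in>{1..r}. x j - y j)"
      using tail[of 1] less.prems(1)[of 1] False by simp
    \<comment> \<open>The weights \<open>1 / x j\<close> increase because \<open>x\<close> is
      decreasing.\<close>
    also have "\<dots> \<le> (\<Sum>j\<in>{1..r}. 1 / x j * (x j - y j))"
      using False less.prems(1,2) tail
      by (intro sum_mult_ge_of_tails) (auto intro!: divide_left_mono mult_pos_pos)
    also have "\<dots> = (\<Sum>j\<in>{1..r}. 1 - y j / x j)"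
      using less.prems(1) by (intro sum.cong) (force simp: field_simps)+
    finally have A: "(\<Sum>j\<in>{1..r}. y j / x j - 1) \<le> 0"
      by (simp add: sum_subtractf)
    have "(\<Prod>i\<in>{1..r}. x i) \<le> 1 - (\<Sum>i\<in>{1..r}. x i)"
      using less.prems(3)[of r] False by simp
    also have "\<dots> \<le> (\<Prod>i\<in>{1..r}. y i)"
      using ge sum_inverse_sylv[of r] unfolding y_def by simp
    finally have "1 \<le> (\<Prod>i\<in>{1..r}. y i / x i)"
      using prod_pos[of "{1..r}" x] less.prems(1) by (simp add: prod_dividef le_divide_eq)
    then have "0 \<le> ln (\<Prod>i\<in>{1..r}. y i / x i)"
      by simp
    also have "\<dots> = (\<Sum>i\<in>{1..r}. ln (y i / x i))"
      using less.prems(1) ypos by (intro ln_prod) (simp_all add: order_less_imp_not_eq2)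
    \<comment> \<open>Each term has the form q - 1 - ln q, which is nonnegative and vanishes only at
      q = 1. A nonpositive total therefore makes every ratio 1.\<close>
    finally have "(\<Sum>i\<in>{1..r}. (y i / x i - 1) - ln (y i / x i)) \<le> 0"
      using A by (simp add: sum_subtractf)
    moreover have nn: "0 \<le> (y i / x i - 1) - ln (y i / x i)" if "i \<in> {1..r}" for i
      using ln_le_minus_one[of "y i / x i"] less.prems(1)[OF that] ypos[of i] by simp
    moreover have "0 \<le> (\<Sum>i\<in>{1..r}. (y i / x i - 1) - ln (y i / x i))"
      using nn by (rule sum_nonneg)
    ultimately have "\<forall>i\<in>{1..r}. (y i / x i - 1) - ln (y i / x i) = 0"
      using sum_nonneg_eq_0_iff[of "{1..r}" "\<lambda>i. (y i / x i - 1) - ln (y i / x i)"] by fastforce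
    then have "\<forall>i\<in>{1..r}. y i / x i = 1"
      using ln_eq_minus_one less.prems(1) ypos by (metis divide_pos_pos eq_iff_diff_eq_0)
    then show ?thesis
      using less.prems(1) by force
  qed simp
  show ?case
  proof (cases "(\<Sum>i\<in>{1..r}. y i) \<le> (\<Sum>i\<in>{1..r}. x i)")
    case True
    from eq[OF True] have "(\<Sum>i\<in>{1..r}. x i) = (\<Sum>i\<in>{1..r}. y i)"
      by (intro sum.cong) auto
    with eq[OF True] show ?thesis by (simp add: y_def)
  qed (simp add: y_def)
qed

text \<open>Pigeonhole form of Minkowski's theorem: the integer vectors \<open>(\<Sum>p) b - M p\<close> form a lattice of
  index \<open>M ^ (card I - 1) * (M - \<Sum>b)\<close>, so two points of the box \<open>\<Prod>[0, b i)\<close> are congruent modulo it.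
  The map \<open>F\<close> below is a complete invariant of the residue classes.\<close>
lemma small_lattice_vector:
  fixes b :: "'a \<Rightarrow> nat" and M :: nat
  assumes I: "finite I" "i0 \<in> I" and BM: "sum b I < M"
    and large: "M ^ (card I - 1) * (M - sum b I) < prod b I"
  shows "\<exists>p::'a \<Rightarrow> int. 0 < sum p I \<and> (\<forall>i\<in>I. \<bar>sum p I * int (b i) - int M * p i\<bar> < int (b i))"
proof -
  define m where "m = int M - int (sum b I)"
  have m: "m > 0" using BM unfolding m_def by linarith
  have M: "int M > 0" using BM by simp
  define Z where "Z = (\<Pi>\<^sub>E i\<in>I. {0..<int (b i)})"
  \<comment> \<open>Adding the lattice vector of \<open>p\<close> to \<open>z\<close> changes
    \<open>sum z I\<close> by - (\<open>sum p I\<close>) m, hence the quotient by -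
    \<open>sum p I\<close>. Adding the quotient times \<open>b\<close> cancels the shift by
    (\<open>sum p I\<close>) b, and only a multiple of \<open>M\<close> remains. Coordinate
    \<open>i0\<close> is omitted because the others and the sum determine it.\<close>
  define F where "F z = (sum z I mod m, restrict (\<lambda>i. (z i + sum z I div m * int (b i)) mod int M) (I - {i0}))"
    for z :: "'a \<Rightarrow> int"
  define T where "T = {0..<m} \<times> (\<Pi>\<^sub>E i\<in>I - {i0}. {0..<int M})"
  have "F ` Z \<subseteq> T"
  proof (rule image_subsetI)
    fix z assume "z \<in> Z"
    have "sum z I mod m \<in> {0..<m}"
      using m by (meson atLeastLessThan_iff pos_mod_bound pos_mod_sign)
    moreover have "k mod int M \<in> {0..<int M}" for k
      using M by (meson atLeastLessThan_iff pos_mod_bound pos_mod_sign)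
    ultimately show "F z \<in> T"
      unfolding F_def T_def by (intro SigmaI restrict_PiE_iff[THEN iffD2] ballI) blast+
  qed
  moreover have finT: "finite T"
    unfolding T_def using I by (auto intro!: finite_PiE)
  moreover have "card T < card Z"
  proof -
    have "nat m = M - sum b I" unfolding m_def by linarith
    then have "card T = M ^ (card I - 1) * (M - sum b I)"
      using I unfolding T_def by (simp add: card_cartesian_product card_PiE)
    moreover have "card Z = prod b I"
      using I unfolding Z_def by (simp add: card_PiE)
    ultimately show ?thesis using large by simp
  qed
  ultimately have "\<not> inj_on F Z"
    using card_inj_on_le not_le by blast
  then obtain z1 z2 where z: "z1 \<in> Z" "z2 \<in> Z" "F z1 = F z2" "z1 \<noteq> z2"
    by (auto simp: inj_on_def)
  define s where "s = sum z2 I div m - sum z1 I div m"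
  define \<delta> where "\<delta> i = z1 i - z2 i" for i
  have small: "\<bar>\<delta> i\<bar> < int (b i)" if "i \<in> I" for i
    using z(1,2) that by (force simp: Z_def \<delta>_def PiE_iff)
  have sum_\<delta>: "sum \<delta> I = - s * m"
  proof -
    have "sum z1 I mod m = sum z2 I mod m" using z(3) by (simp add: F_def)
    then have "sum z1 I - sum z2 I = (sum z1 I div m - sum z2 I div m) * m"
      by (metis add_diff_cancel_right left_diff_distrib div_mult_mod_eq)
    then show ?thesis by (simp add: \<delta>_def s_def sum_subtractf algebra_simps)
  qed
  have dvd1: "int M dvd s * int (b i) - \<delta> i" if "i \<in> I - {i0}" for i
  proof -
    have "(z1 i + sum z1 I div m * int (b i)) mod int M = (z2 i + sum z2 I div m * int (b i)) mod int M"
      using z(3) that by (auto simp: F_def dest: fun_cong[of _ _ i])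
    then have "int M dvd (z2 i + sum z2 I div m * int (b i)) - (z1 i + sum z1 I div m * int (b i))"
      by (metis mod_eq_dvd_iff)
    then show ?thesis by (simp add: \<delta>_def s_def algebra_simps)
  qed
  have total: "(\<Sum>i\<in>I. s * int (b i) - \<delta> i) = s * int M"
    unfolding sum_subtractf sum_\<delta> sum_distrib_left[symmetric] m_def
    by (simp add: algebra_simps)
  \<comment> \<open>Divisibility in the omitted coordinate follows from the other coordinates and
    the total \<open>s * int M\<close>.\<close>
  have dvd0: "int M dvd s * int (b i0) - \<delta> i0"
  proof -
    have e: "s * int (b i0) - \<delta> i0 = s * int M - (\<Sum>i\<in>I - {i0}. s * int (b i) - \<delta> i)"
      using total sum.remove[OF I, of "\<lambda>i. s * int (b i) - \<delta> i"] by simp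
    have "int M dvd (\<Sum>i\<in>I - {i0}. s * int (b i) - \<delta> i)"
      by (rule dvd_sum) (rule dvd1)
    then show ?thesis
      unfolding e by (rule dvd_diff[OF dvd_triv_right])
  qed
  define p where "p i = (s * int (b i) - \<delta> i) div int M" for i
  have p: "int M * p i = s * int (b i) - \<delta> i" if "i \<in> I" for i
    using dvd0 dvd1 that unfolding p_def by (metis Diff_iff dvd_mult_div_cancel singletonD)
  have sum_p: "sum p I = s"
  proof -
    have "int M * sum p I = s * int M"
      using total by (simp add: sum_distrib_left p)
    then show ?thesis using M by simp
  qed
  have ineq: "\<bar>s * int (b i) - int M * p i\<bar> < int (b i)" if "i \<in> I" for i
    using small p that by simp
  \<comment> \<open>For \<open>s = 0\<close> the inequalities read \<bar>M p i\<bar> < b i < M, so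
    \<open>p\<close> vanishes and the two colliding points are equal.\<close>
  have "s \<noteq> 0"
  proof
    assume s0: "s = 0"
    have "\<delta> i = 0" if i: "i \<in> I" for i
    proof -
      have "b i \<le> sum b I" using I i by (simp add: member_le_sum)
      then have "\<bar>int M * p i\<bar> < int M" using ineq[OF i] s0 BM by simp
      then have "p i = 0" using M by (simp add: abs_mult)
      then show ?thesis using p[OF i] s0 by simp
    qed
    then have "z1 = z2" using z(1,2) unfolding Z_def \<delta>_def by (auto intro: PiE_ext)
    then show False using z by simp
  qed
  then consider "s > 0" | "s < 0" by linarith
  then show ?thesis
  proof cases
    case 1
    then show ?thesis using ineq sum_p by blast
  next
    case 2
    have "\<bar>sum (\<lambda>i. - p i) I * int (b i) - int M * - p i\<bar> < int (b i)" if "i \<in> I" for i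
      using ineq[OF that] by (simp add: sum_negf sum_p)
    then show ?thesis using 2 sum_p by (intro exI[of _ "\<lambda>i. - p i"]) (auto simp: sum_negf)
  qed
qed

lemma decreasing_enumeration:
  fixes \<beta> :: "'a \<Rightarrow> real"
  assumes "finite D"
  obtains v where "bij_betw v {1..card D} D"
    "\<And>i j. 1 \<le> i \<Longrightarrow> i \<le> j \<Longrightarrow> j \<le> card D \<Longrightarrow> \<beta> (v j) \<le> \<beta> (v i)"
proof -
  obtain xs where xs: "set xs = D" "distinct xs"
    using assms finite_distinct_list by blast
  define ys where "ys = sort_key (\<lambda>d. - \<beta> d) xs"
  have ys: "set ys = D" "distinct ys" "length ys = card D" "sorted (map (\<lambda>d. - \<beta> d) ys)"
    using xs by (auto simp: ys_def distinct_card)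
  show thesis
  proof
    have "bij_betw ((!) ys) {..<card D} D"
      using ys by (intro bij_betw_nth) auto
    moreover have "bij_betw (\<lambda>i. i - 1) {1..card D} {..<card D}"
      by (rule bij_betwI[where g = Suc]) auto
    ultimately show "bij_betw (\<lambda>i. ys ! (i - 1)) {1..card D} D"
      using bij_betw_trans by (force simp: o_def)
    fix i j :: nat
    assume "1 \<le> i" "i \<le> j" "j \<le> card D"
    then show "\<beta> (ys ! (j - 1)) \<le> \<beta> (ys ! (i - 1))"
      using sorted_nth_mono[OF ys(4), of "i-1" "j-1"] ys(3) by simp
  qed
qed

section \<open>Lattice points and lattice diameter\<close>

lemma lattice_0: "0 \<in> lattice"
  by (simp add: lattice_def)

lemma lattice_add: "x \<in> lattice \<Longrightarrow> y \<in> lattice \<Longrightarrow> x + y \<in> lattice"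
  by (simp add: lattice_def)

lemma lattice_diff: "x \<in> lattice \<Longrightarrow> y \<in> lattice \<Longrightarrow> x - y \<in> lattice"
  by (simp add: lattice_def)

lemma lattice_scaleR: "c \<in> \<int> \<Longrightarrow> x \<in> lattice \<Longrightarrow> c *\<^sub>R x \<in> lattice"
  by (simp add: lattice_def)

lemma lattice_sum: "(\<And>i. i \<in> I \<Longrightarrow> f i \<in> lattice) \<Longrightarrow> sum f I \<in> lattice"
  by (simp add: lattice_def Ints_sum)

lemma axis_in_lattice: "axis i 1 \<in> lattice"
  by (simp add: lattice_def axis_def)

lemma finite_lattice_Int:
  fixes B :: "(real^'n) set"
  assumes "bounded B"
  shows "finite (B \<inter> lattice)"
proof -
  obtain R where R: "\<And>x. x \<in> B \<Longrightarrow> norm x \<le> R"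
    using assms by (auto simp: bounded_iff)
  define C where "C = real_of_int ` {\<lfloor>-R\<rfloor>..\<lceil>R\<rceil>}"
  have "B \<inter> lattice \<subseteq> vec_lambda ` (\<Pi>\<^sub>E i\<in>(UNIV::'n set). C)"
  proof
    fix x assume x: "x \<in> B \<inter> lattice"
    have "x $ i \<in> C" for i
    proof -
      obtain k where k: "x $ i = of_int k"
        using x by (auto simp: lattice_def elim: Ints_cases)
      have "\<bar>x $ i\<bar> \<le> R"
        using R[of x] component_le_norm_cart[of x i] x by auto
      then show ?thesis
        unfolding C_def k by (intro imageI) (simp add: k, linarith)
    qed
    then show "x \<in> vec_lambda ` (\<Pi>\<^sub>E i\<in>UNIV. C)"
      by (intro image_eqI[of _ _ "\<lambda>i. x $ i"]) auto
  qed
  then show ?thesis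
    by (rule finite_subset) (auto simp: C_def intro!: finite_PiE)
qed

lemma rational_line_lattice:
  assumes "p \<in> lattice" "q \<in> lattice" "p \<noteq> q"
  shows "rational_line (affine hull {p, q})"
  unfolding rational_line_def using assms Ints_subset_Rats by (fastforce simp: lattice_def)

lemma ex_rational_line_through:
  fixes z :: "real^'n"
  assumes "z \<in> lattice"
  obtains g where "rational_line g" "z \<in> g"
proof -
  obtain i :: 'n where True by simp
  have "axis i 1 \<noteq> (0::real^'n)" by (simp add: axis_eq_0_iff)
  then have "rational_line (affine hull {z, z + axis i 1})"
    using assms by (intro rational_line_lattice lattice_add axis_in_lattice) auto
  then show thesis using that by (simp add: hull_inc)
qed

context
  fixes Q :: "(real^'n) set"
  assumes fin: "finite (Q \<inter> lattice)"
begin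

text \<open>\<open>Max\<close> in the definition of \<open>ld\<close> is informative only on a
  finite set. The number of lattice points of \<open>Q\<close> bounds every count.\<close>

lemma finite_ld_set: "finite {int (card (Q \<inter> lattice \<inter> g)) - 1 | g. rational_line g}"
proof (rule finite_subset)
  show "{int (card (Q \<inter> lattice \<inter> g)) - 1 | g. rational_line g} \<subseteq> (\<lambda>k. int k - 1) ` {..card (Q \<inter> lattice)}"
    using fin by (auto intro!: imageI card_mono)
qed simp

lemma ld_ge: "rational_line g \<Longrightarrow> int (card (Q \<inter> lattice \<inter> g)) - 1 \<le> ld Q"
  unfolding ld_def using finite_ld_set by (intro Max_ge) auto

lemma ld_attained:
  obtains g where "rational_line g" "ld Q = int (card (Q \<inter> lattice \<inter> g)) - 1"
proof -
  obtain g :: "(real^'n) set" where "rational_line g"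
    using ex_rational_line_through lattice_0 by blast
  then have "ld Q \<in> {int (card (Q \<inter> lattice \<inter> g)) - 1 | g. rational_line g}"
    unfolding ld_def using finite_ld_set by (intro Max_in) auto
  then show thesis using that by blast
qed

lemma ld_nonneg:
  assumes "z \<in> Q" "z \<in> lattice"
  shows "0 \<le> ld Q"
proof -
  obtain g where g: "rational_line g" "z \<in> g"
    using ex_rational_line_through assms by blast
  then have "card (Q \<inter> lattice \<inter> g) > 0"
    using assms fin by (auto simp: card_gt_0_iff)
  then show ?thesis using ld_ge[OF g(1)] by linarith
qed

end

section \<open>Primitive directions and lattice points on parallel lines\<close>

text \<open>Fix a nonzero coordinate i of \<open>w\<close>. Lattice vectors parallel to
  \<open>w\<close> have an integral i-th coordinate, so its absolute value n has a least positive
  value; \<open>u\<close> attains it. Reducing a lattice vector \<open>c *\<^sub>R u\<close> by the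
  integer part of \<open>c\<close> leaves a coordinate smaller than n in absolute value, which must
  vanish.\<close>

lemma primitive_vector:
  fixes w :: "real^'n"
  assumes "w \<in> lattice" "w \<noteq> 0"
  obtains u N where "u \<in> lattice" "u \<noteq> 0" "0 < N" "w = N *\<^sub>R u" "\<And>c. c *\<^sub>R u \<in> lattice \<Longrightarrow> c \<in> \<int>"
proof -
  obtain i where i: "w $ i \<noteq> 0"
    using assms(2) by (auto simp: vec_eq_iff)
  define T where "T n \<longleftrightarrow> 0 < n \<and> (real n / \<bar>w $ i\<bar>) *\<^sub>R w \<in> lattice" for n :: nat
  have "T (nat \<lfloor>\<bar>w $ i\<bar>\<rfloor>)"
  proof -
    have "\<bar>w $ i\<bar> \<in> \<int>" using assms(1) by (auto simp: lattice_def)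
    then have "real (nat \<lfloor>\<bar>w $ i\<bar>\<rfloor>) = \<bar>w $ i\<bar>" by (auto elim: Ints_cases)
    then show ?thesis unfolding T_def using i assms(1) by (auto simp: zero_less_iff_neq_zero)
  qed
  then obtain n where n: "T n" "\<And>m. m < n \<Longrightarrow> \<not> T m"
    using exists_least_iff[of T] by blast
  define u where "u = (real n / \<bar>w $ i\<bar>) *\<^sub>R w"
  have u: "u \<in> lattice" "n > 0" using n(1) by (auto simp: T_def u_def)
  show thesis
  proof
    show "u \<in> lattice" by fact
    show "u \<noteq> 0" using u i assms(2) by (simp add: u_def)
    show "0 < \<bar>w $ i\<bar> / real n" "w = (\<bar>w $ i\<bar> / real n) *\<^sub>R u"
      using u i by (auto simp: u_def)
    fix c assume c: "c *\<^sub>R u \<in> lattice"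
    have f: "frac c *\<^sub>R u \<in> lattice"
      unfolding frac_def scaleR_left_diff_distrib by (rule lattice_diff[OF c lattice_scaleR[OF Ints_of_int u(1)]])
    then have "frac c * real n \<in> \<int>"
    proof -
      have "(frac c *\<^sub>R u) $ i = frac c * real n * sgn (w $ i)"
        using i by (simp add: u_def sgn_real_def)
      then have "frac c * real n * sgn (w $ i) \<in> \<int>" using f by (metis (mono_tags, lifting) lattice_def mem_Collect_eq)
      then show ?thesis using i by (cases "w $ i > 0") (auto simp: sgn_real_def)
    qed
    moreover have "0 \<le> frac c * real n" by simp
    ultimately obtain m :: nat where m: "frac c * real n = real m"
      by (metis Ints_cases of_int_0_le_iff of_int_of_nat_eq zero_le_imp_eq_int)
    have "frac c * real n < 1 * real n"
      using frac_lt_1[of c] u(2) by (intro mult_strict_right_mono) auto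
    then have "m < n" by (simp add: m)
    moreover have "(real m / \<bar>w $ i\<bar>) *\<^sub>R w \<in> lattice"
      using f by (simp add: u_def m[symmetric])
    ultimately have "m = 0" using n(2)[of m] by (auto simp: T_def)
    then show "c \<in> \<int>" using m u(2) by (simp add: frac_eq_0_iff)
  qed
qed

text \<open>An open interval of length greater than \<open>K\<close>, or of length \<open>K\<close> with non-integral end points,
  contains at least \<open>K\<close> integers.\<close>
lemma fibre_length_le:
  fixes P :: "(real^'n) set" and K :: int
  assumes P: "convex P" and fin: "finite (interior P \<inter> lattice)"
    and bound: "\<And>g. rational_line g \<Longrightarrow> int (card (interior P \<inter> lattice \<inter> g)) < K"
    and u: "u \<in> lattice" "u \<noteq> 0" and z: "z \<in> lattice"
    and c: "z + \<kappa> *\<^sub>R u \<in> interior P"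
    and ends: "z + \<tau> *\<^sub>R u \<in> P" "z + (\<tau> + l) *\<^sub>R u \<in> P"
  shows "l \<le> K \<and> (l = K \<longrightarrow> \<tau> \<in> \<int>)"
proof (rule ccontr)
  assume neg: "\<not> ?thesis"
  define g where "g = affine hull {z, z + u}"
  have g: "rational_line g"
    unfolding g_def using u z by (intro rational_line_lattice lattice_add) auto
  have int: "z + t *\<^sub>R u \<in> interior P" if t: "\<tau> < t" "t < \<tau> + l" for t
  proof -
    \<comment> \<open>The end of the segment for which \<open>t\<close> lies between
      \<open>e\<close> and \<open>\<kappa>\<close> and differs from \<open>e\<close>. The point at
      \<open>t\<close> then has a positive share of the interior point at \<open>\<kappa>\<close>,
      even if \<open>\<kappa>\<close> lies outside the segment.\<close>
    define e where "e = (if t \<le> \<kappa> then \<tau> else \<tau> + l)"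
    have eP: "z + e *\<^sub>R u \<in> P" using ends by (simp add: e_def)
    define \<theta> where "\<theta> = (t - e) / (\<kappa> - e)"
    have \<theta>: "0 < \<theta>" "\<theta> \<le> 1" "\<kappa> \<noteq> e"
      using t by (auto simp: \<theta>_def e_def divide_simps)
    have eq: "z + t *\<^sub>R u = (z + e *\<^sub>R u) - \<theta> *\<^sub>R ((z + e *\<^sub>R u) - (z + \<kappa> *\<^sub>R u))"
    proof -
      have t: "t = e + \<theta> * (\<kappa> - e)" using \<theta>(3) by (simp add: \<theta>_def)
      show ?thesis by (subst t) (simp add: algebra_simps)
    qed
    show ?thesis
      unfolding eq by (rule mem_interior_convex_shrink[OF P c eP \<theta>(1,2)])
  qed
  define h where "h k = z + real_of_int k *\<^sub>R u" for k
  have "h k \<in> interior P \<inter> lattice \<inter> g" if "k \<in> {\<lfloor>\<tau>\<rfloor> + 1..\<lfloor>\<tau>\<rfloor> + K}" for k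
  proof -
    have "real_of_int k > \<tau>" using that by (simp, linarith)
    moreover have "real_of_int k < \<tau> + l"
    proof -
      have "k \<le> \<lfloor>\<tau>\<rfloor> + K" using that by simp
      then have "real_of_int k \<le> of_int \<lfloor>\<tau>\<rfloor> + of_int K" by linarith
      moreover have "of_int \<lfloor>\<tau>\<rfloor> + of_int K < \<tau> + l"
      proof (cases "l = K")
        case True
        then have "\<tau> \<notin> \<int>" using neg by simp
        then have "of_int \<lfloor>\<tau>\<rfloor> \<noteq> \<tau>" by (metis Ints_of_int)
        then have "of_int \<lfloor>\<tau>\<rfloor> < \<tau>" by linarith
        with True show ?thesis by linarith
      next
        case False
        then have "l > K" using neg by simp
        then show ?thesis by linarith
      qed
      ultimately show ?thesis by linarith
    qed
    ultimately have "h k \<in> interior P" unfolding h_def by (rule int)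
    moreover have "h k \<in> lattice"
      unfolding h_def using u z by (intro lattice_add lattice_scaleR) auto
    moreover have "h k \<in> g"
      unfolding g_def h_def affine_hull_2
      by (rule CollectI, rule exI[of _ "1 - of_int k"], rule exI[of _ "of_int k"]) (simp add: algebra_simps)
    ultimately show ?thesis by blast
  qed
  then have "h ` {\<lfloor>\<tau>\<rfloor> + 1..\<lfloor>\<tau>\<rfloor> + K} \<subseteq> interior P \<inter> lattice \<inter> g" by blast
  moreover have "inj h" using u(2) by (auto simp: inj_def h_def)
  ultimately have "card {\<lfloor>\<tau>\<rfloor> + 1..\<lfloor>\<tau>\<rfloor> + K} \<le> card (interior P \<inter> lattice \<inter> g)"
    using fin by (meson card_inj_on_le finite_Int inj_on_subset subset_UNIV)
  then show False using bound[OF g] by simp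
qed

section \<open>Convex combinations and Caratheodory's theorem modulo a line\<close>

text \<open>The weight not assigned to the points \<open>a + d\<close>, \<open>w\<close> and
  \<open>b\<close> goes to \<open>a\<close>.\<close>

lemma convex_combination_from_vertex:
  fixes P :: "'v::real_vector set"
  assumes P: "convex P" "a \<in> P" "w \<in> P" "b \<in> P" and D: "finite D" "\<And>d. d \<in> D \<Longrightarrow> a + d \<in> P"
    and \<beta>: "\<And>d. d \<in> D \<Longrightarrow> 0 \<le> \<beta> d" and "0 \<le> \<epsilon>" "0 \<le> \<mu>" "sum \<beta> D + \<epsilon> + \<mu> \<le> 1"
  shows "a + (\<Sum>d\<in>D. \<beta> d *\<^sub>R d) + \<epsilon> *\<^sub>R (w - a) + \<mu> *\<^sub>R (b - a) \<in> P"
proof -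
  \<comment> \<open>A disjoint sum as index set allows the points to coincide: \<open>None\<close>
    stands for \<open>a\<close>, \<open>Some True\<close> for \<open>w\<close> and
    \<open>Some False\<close> for \<open>b\<close>.\<close>
  define f where "f = case_sum (\<lambda>d. a + d) (case_option a (\<lambda>t. if t then w else b))"
  define c where "c = case_sum \<beta> (case_option (1 - sum \<beta> D - \<epsilon> - \<mu>) (\<lambda>t. if t then \<epsilon> else \<mu>))"
  have fin: "finite (D <+> (UNIV :: bool option set))" using D by simp
  have Plus: "sum h (D <+> (UNIV :: bool option set))
      = (\<Sum>d\<in>D. h (Inl d)) + (h (Inr None) + (h (Inr (Some True)) + h (Inr (Some False))))"
    for h :: "'v + bool option \<Rightarrow> 'w::real_vector"
    using D by (simp add: sum.Plus UNIV_option_conv UNIV_bool add.commute)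
  have "(\<Sum>i\<in>D <+> UNIV. c i *\<^sub>R f i) \<in> P"
  proof (rule convex_sum[OF fin P(1)])
    show "sum c (D <+> UNIV) = 1"
      unfolding Plus by (simp add: c_def)
    show "0 \<le> c i" if "i \<in> D <+> UNIV" for i
      using that assms by (auto simp: c_def split: option.splits)
    show "f i \<in> P" if "i \<in> D <+> UNIV" for i
      using that assms by (auto simp: f_def split: option.splits)
  qed
  also have "(\<Sum>i\<in>D <+> UNIV. c i *\<^sub>R f i) = a + (\<Sum>d\<in>D. \<beta> d *\<^sub>R d) + \<epsilon> *\<^sub>R (w - a) + \<mu> *\<^sub>R (b - a)"
  proof -
    have "(\<Sum>d\<in>D. \<beta> d *\<^sub>R (a + d)) = sum \<beta> D *\<^sub>R a + (\<Sum>d\<in>D. \<beta> d *\<^sub>R d)"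
      by (simp add: scaleR_add_right sum.distrib scaleR_sum_left)
    then show ?thesis
      unfolding Plus c_def f_def by (simp add: algebra_simps)
  qed
  finally show ?thesis .
qed

text \<open>Caratheodory's theorem modulo the line spanned by \<open>u\<close>, keeping the weight \<open>1 - \<Sum>\<beta>\<close> of the
  origin positive: along a linear dependency one moves in the direction that does not decrease it.\<close>
lemma caratheodory_modulo_line:
  fixes y u :: "'v::real_vector"
  assumes u: "u \<noteq> 0" and D0: "finite D0"
    and y: "y = (\<Sum>d\<in>D0. \<beta>0 d *\<^sub>R d)" "\<And>d. d \<in> D0 \<Longrightarrow> 0 \<le> \<beta>0 d" "sum \<beta>0 D0 < 1"
  obtains D \<beta> \<tau> where "D \<subseteq> D0" "u \<notin> D" "independent (insert u D)"
    "\<And>d. d \<in> D \<Longrightarrow> 0 < \<beta> d" "sum \<beta> D < 1" "y = (\<Sum>d\<in>D. \<beta> d *\<^sub>R d) + \<tau> *\<^sub>R u"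
proof -
  define \<Phi> where "\<Phi> D \<longleftrightarrow> D \<subseteq> D0 \<and> (\<exists>\<beta> \<tau>. (\<forall>d\<in>D. 0 < \<beta> d) \<and> sum \<beta> D < 1 \<and> y = (\<Sum>d\<in>D. \<beta> d *\<^sub>R d) + \<tau> *\<^sub>R u)" for D
  have support: "\<Phi> {d \<in> D. 0 < \<beta> d}"
    if "D \<subseteq> D0" "\<And>d. d \<in> D \<Longrightarrow> 0 \<le> \<beta> d" "sum \<beta> D < 1" "y = (\<Sum>d\<in>D. \<beta> d *\<^sub>R d) + \<tau> *\<^sub>R u" for D \<beta> \<tau>
  proof -
    have D: "finite D" using that(1) D0 finite_subset by blast
    have z: "\<beta> d = 0" if "d \<in> D - {d \<in> D. 0 < \<beta> d}" for d
      using \<open>\<And>d. d \<in> D \<Longrightarrow> 0 \<le> \<beta> d\<close>[of d] that by auto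
    have "sum \<beta> {d \<in> D. 0 < \<beta> d} = sum \<beta> D"
      using D z by (intro sum.mono_neutral_left) auto
    moreover have "(\<Sum>d\<in>{d \<in> D. 0 < \<beta> d}. \<beta> d *\<^sub>R d) = (\<Sum>d\<in>D. \<beta> d *\<^sub>R d)"
      using D z by (intro sum.mono_neutral_left) auto
    ultimately show ?thesis
      unfolding \<Phi>_def using that by (intro conjI exI[of _ \<beta>] exI[of _ \<tau>]) auto
  qed
  have "\<Phi> {d \<in> D0. 0 < \<beta>0 d}"
    using y by (intro support[of _ _ 0]) auto
  then obtain D where D: "\<Phi> D" "\<And>D'. card D' < card D \<Longrightarrow> \<not> \<Phi> D'"
    using ex_has_least_nat[of \<Phi> _ card] by (metis not_le)
  then obtain \<beta> \<tau> where \<beta>: "D \<subseteq> D0" "\<And>d. d \<in> D \<Longrightarrow> 0 < \<beta> d" "sum \<beta> D < 1"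
    "y = (\<Sum>d\<in>D. \<beta> d *\<^sub>R d) + \<tau> *\<^sub>R u"
    unfolding \<Phi>_def by blast
  have finD: "finite D" using \<beta>(1) D0 finite_subset by blast
  \<comment> \<open>If \<open>u\<close> were in \<open>D\<close>, its coefficient could be absorbed
    into \<open>\<tau>\<close>, contradicting the minimality of \<open>D\<close>.\<close>
  have uD: "u \<notin> D"
  proof
    assume uD: "u \<in> D"
    have "\<Phi> (D - {u})"
      unfolding \<Phi>_def
    proof (intro conjI exI[of _ \<beta>] exI[of _ "\<tau> + \<beta> u"])
      show "sum \<beta> (D - {u}) < 1" using \<beta>(2,3) uD finD by (simp add: sum_diff1) (smt (verit))
      show "y = (\<Sum>d\<in>D - {u}. \<beta> d *\<^sub>R d) + (\<tau> + \<beta> u) *\<^sub>R u"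
        using \<beta>(4) sum.remove[OF finD uD, of "\<lambda>d. \<beta> d *\<^sub>R d"] by (simp add: algebra_simps)
    qed (use \<beta> in auto)
    then show False using D(2)[of "D - {u}"] uD finD by (metis card_Diff1_less)
  qed
  have "independent (insert u D)"
  proof
    assume "dependent (insert u D)"
    then obtain w0 v0 where w0: "v0 \<in> insert u D" "w0 v0 \<noteq> 0" "(\<Sum>v\<in>insert u D. w0 v *\<^sub>R v) = 0"
      using finD by (auto simp: dependent_finite)
    have nz: "\<exists>d\<in>D. w0 d \<noteq> 0"
    proof (rule ccontr)
      assume z: "\<not> ?thesis"
      then have "(\<Sum>v\<in>D. w0 v *\<^sub>R v) = 0" by (intro sum.neutral) auto
      then show False using w0 u uD finD z by auto
    qed
    \<comment> \<open>Of the two signs of the dependency, the one whose sum over \<open>D\<close> is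
      nonpositive, so that adding a positive multiple does not lower the weight of the
      origin.\<close>
    define w where "w = (if sum w0 D \<le> 0 then w0 else (\<lambda>d. - w0 d))"
    have w: "sum w D \<le> 0" "\<exists>d\<in>D. w d \<noteq> 0" "(\<Sum>d\<in>D. w d *\<^sub>R d) = - w u *\<^sub>R u"
      using nz w0(3) uD finD by (auto simp: w_def sum_negf add_eq_0_iff)
    have "\<exists>d\<in>D. w d < 0"
    proof (rule ccontr)
      assume "\<not> ?thesis"
      then have nn: "\<forall>d\<in>D. 0 \<le> w d" by auto
      then have "sum w D = 0" using w(1) by (simp add: antisym sum_nonneg)
      then show False using nn w(2) sum_nonneg_eq_0_iff[OF finD] by blast
    qed
    then have ne: "{d \<in> D. w d < 0} \<noteq> {}" by auto
    have "finite {d \<in> D. w d < 0}" using finD by simp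
    then obtain d0 where d0: "d0 \<in> D" "w d0 < 0"
      and min: "\<And>d. d \<in> D \<Longrightarrow> w d < 0 \<Longrightarrow> \<beta> d0 / - w d0 \<le> \<beta> d / - w d"
      using ne arg_min_if_finite[of _ "\<lambda>d. \<beta> d / - w d"] by (smt (verit) mem_Collect_eq)
    \<comment> \<open>The step length at which the first coefficient reaches zero; the support then
      loses \<open>d0\<close>.\<close>
    define \<epsilon> where "\<epsilon> = \<beta> d0 / - w d0"
    have \<epsilon>: "\<epsilon> > 0" using \<beta>(2) d0 by (simp add: \<epsilon>_def divide_pos_neg)
    define \<beta>' where "\<beta>' d = \<beta> d + \<epsilon> * w d" for d
    have "\<Phi> {d \<in> D. 0 < \<beta>' d}"
    proof (rule support)
      show "0 \<le> \<beta>' d" if "d \<in> D" for d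
      proof (cases "w d < 0")
        case True
        then have "\<epsilon> \<le> \<beta> d / - w d" using min that by (simp add: \<epsilon>_def)
        then show ?thesis using True by (simp add: \<beta>'_def field_simps)
      next
        case False
        then show ?thesis using \<beta>(2)[OF that] \<epsilon> by (simp add: \<beta>'_def)
      qed
      have "sum \<beta>' D = sum \<beta> D + \<epsilon> * sum w D"
        by (simp add: \<beta>'_def sum.distrib sum_distrib_left)
      then show "sum \<beta>' D < 1"
        using \<beta>(3) w(1) \<epsilon> mult_nonneg_nonpos[of \<epsilon> "sum w D"] by linarith
      have "(\<Sum>d\<in>D. \<beta>' d *\<^sub>R d) = (\<Sum>d\<in>D. \<beta> d *\<^sub>R d) + \<epsilon> *\<^sub>R (\<Sum>d\<in>D. w d *\<^sub>R d)"
        by (simp add: \<beta>'_def algebra_simps sum.distrib scaleR_sum_right)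
      then show "y = (\<Sum>d\<in>D. \<beta>' d *\<^sub>R d) + (\<tau> + \<epsilon> * w u) *\<^sub>R u"
        using \<beta>(4) by (simp add: w(3) algebra_simps)
    qed (use \<beta> in auto)
    moreover have "\<beta>' d0 = 0" using d0 by (simp add: \<beta>'_def \<epsilon>_def)
    then have "{d \<in> D. 0 < \<beta>' d} \<subset> D"
      using d0 by force
    then have "card {d \<in> D. 0 < \<beta>' d} < card D"
      using finD by (rule psubset_card_mono[rotated])
    ultimately show False using D(2) by blast
  qed
  then show thesis using that[of D \<beta> \<tau>] \<beta> uD by blast
qed

section \<open>Simplices modulo a line\<close>

lemma ex_small_multiplier:
  fixes c e :: "'a \<Rightarrow> real"
  assumes "finite I" "\<And>i. i \<in> I \<Longrightarrow> 0 < c i"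
  obtains \<eta> where "0 < \<eta>" "\<eta> < 1" "\<And>i. i \<in> I \<Longrightarrow> \<eta> * e i < c i"
proof -
  have "\<forall>\<^sub>F \<eta> in at_right 0. \<eta> * e i < c i" if "i \<in> I" for i
  proof -
    have "((\<lambda>\<eta>. \<eta> * e i) \<longlongrightarrow> 0 * e i) (at_right 0)"
      by (intro tendsto_intros)
    then show ?thesis
      using assms(2)[OF that] by (intro order_tendstoD(2)) auto
  qed
  then have "\<forall>\<^sub>F \<eta> in at_right 0. \<forall>i\<in>I. \<eta> * e i < c i"
    using assms(1) by (simp add: eventually_ball_finite)
  moreover have "\<forall>\<^sub>F \<eta> in at_right (0::real). 0 < \<eta> \<and> \<eta> < 1"
    by (rule eventually_at_rightI[of 0 1]) auto
  ultimately have "\<forall>\<^sub>F \<eta> in at_right 0. (\<forall>i\<in>I. \<eta> * e i < c i) \<and> 0 < \<eta> \<and> \<eta> < 1"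
    by eventually_elim blast
  then obtain \<eta> where "(\<forall>i\<in>I. \<eta> * e i < c i) \<and> 0 < \<eta> \<and> \<eta> < 1"
    using eventually_happens'[OF trivial_limit_at_right_real] by blast
  then show thesis using that by blast
qed

text \<open>Modulo the direction \<open>u\<close>, the points \<open>a\<close> and
  \<open>a + d\<close> span a simplex, possibly of lower dimension than the quotient.
  \<open>seed\<close> provides an interior lattice point over its relative interior, and
  \<open>fibre\<close> is the conclusion of \<open>fibre_length_le\<close> for an abstract real
  bound \<open>K\<close>.\<close>

locale fibred_simplex =
  fixes P :: "(real^'n) set" and a u :: "real^'n" and L K :: real and D :: "(real^'n) set"
  assumes convex_P: "convex P"
    and a: "a \<in> lattice" "a \<in> P"
    and u: "u \<in> lattice" "u \<noteq> 0"
    and b: "a + L *\<^sub>R u \<in> P" and L: "0 < L"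
    and D: "finite D" "D \<subseteq> lattice" "\<And>d. d \<in> D \<Longrightarrow> a + d \<in> P"
    and indep: "u \<notin> D" "independent (insert u D)"
    and seed: "\<exists>\<gamma> \<tau>. (\<forall>d\<in>D. 0 < \<gamma> d) \<and> sum \<gamma> D < 1 \<and> a + (\<Sum>d\<in>D. \<gamma> d *\<^sub>R d) + \<tau> *\<^sub>R u \<in> interior P \<inter> lattice"
    and fibre: "\<And>z \<kappa> \<tau> l. z \<in> lattice \<Longrightarrow> z + \<kappa> *\<^sub>R u \<in> interior P \<Longrightarrow> z + \<tau> *\<^sub>R u \<in> P
      \<Longrightarrow> z + (\<tau> + l) *\<^sub>R u \<in> P \<Longrightarrow> l \<le> K \<and> (l = K \<longrightarrow> \<tau> \<in> \<int>)"
begin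

lemma in_P:
  assumes "w \<in> P" "\<And>d. d \<in> D \<Longrightarrow> 0 \<le> \<beta> d" "0 \<le> \<epsilon>" "0 \<le> \<mu>" "sum \<beta> D + \<epsilon> + \<mu> \<le> 1"
  shows "a + (\<Sum>d\<in>D. \<beta> d *\<^sub>R d) + \<epsilon> *\<^sub>R (w - a) + (\<mu> * L) *\<^sub>R u \<in> P"
  using convex_combination_from_vertex[OF convex_P a(2) assms(1) b D(1,3) assms(2-5)] by simp

text \<open>Up to a shift along \<open>u\<close>, the point is a convex combination of the interior
  point from \<open>seed\<close> and a point \<open>y\<close> of \<open>P\<close>, with positive
  share \<eta> for the former.\<close>

lemma meets_interior:
  assumes w: "w \<in> P" and \<beta>: "\<And>d. d \<in> D \<Longrightarrow> 0 < \<beta> d" and \<epsilon>: "0 \<le> \<epsilon>" and less1: "sum \<beta> D + \<epsilon> < 1"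
  shows "\<exists>\<kappa>. a + (\<Sum>d\<in>D. \<beta> d *\<^sub>R d) + \<epsilon> *\<^sub>R (w - a) + \<kappa> *\<^sub>R u \<in> interior P"
proof -
  obtain \<gamma> \<tau> where \<gamma>: "\<And>d. d \<in> D \<Longrightarrow> 0 < \<gamma> d" "sum \<gamma> D < 1"
    and c: "a + (\<Sum>d\<in>D. \<gamma> d *\<^sub>R d) + \<tau> *\<^sub>R u \<in> interior P"
    using seed by blast
  define c where "c = a + (\<Sum>d\<in>D. \<gamma> d *\<^sub>R d) + \<tau> *\<^sub>R u"
  obtain \<eta>0 where \<eta>0: "0 < \<eta>0" "\<eta>0 < 1" "\<And>d. d \<in> D \<Longrightarrow> \<eta>0 * \<gamma> d < \<beta> d"
    using ex_small_multiplier[of D \<beta> \<gamma>] D(1) \<beta> by blast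
  \<comment> \<open>Small enough that \<open>\<beta> d - \<eta> * \<gamma> d\<close> stays
    nonnegative and that the weights of \<open>y\<close>, after division by
    \<open>1 - \<eta>\<close>, still sum to at most 1.\<close>
  define \<eta> where "\<eta> = min \<eta>0 (1 - sum \<beta> D - \<epsilon>)"
  have \<eta>: "0 < \<eta>" "\<eta> < 1" "\<eta> \<le> 1 - sum \<beta> D - \<epsilon>"
    using \<eta>0 less1 by (auto simp: \<eta>_def)
  have \<eta>\<gamma>: "\<eta> * \<gamma> d \<le> \<beta> d" if "d \<in> D" for d
  proof -
    have "\<eta> * \<gamma> d \<le> \<eta>0 * \<gamma> d"
      using \<gamma>(1)[OF that] by (intro mult_right_mono) (auto simp: \<eta>_def)
    then show ?thesis using \<eta>0(3)[OF that] by linarith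
  qed
  define SB where "SB = (\<Sum>d\<in>D. \<beta> d *\<^sub>R d)"
  define SG where "SG = (\<Sum>d\<in>D. \<gamma> d *\<^sub>R d)"
  define y where "y = a + (1 / (1 - \<eta>)) *\<^sub>R (SB - \<eta> *\<^sub>R SG) + (\<epsilon> / (1 - \<eta>)) *\<^sub>R (w - a)"
  have "a + (\<Sum>d\<in>D. ((\<beta> d - \<eta> * \<gamma> d) / (1 - \<eta>)) *\<^sub>R d) + (\<epsilon> / (1 - \<eta>)) *\<^sub>R (w - a) + (0 * L) *\<^sub>R u \<in> P"
  proof (rule in_P[OF w])
    show "0 \<le> (\<beta> d - \<eta> * \<gamma> d) / (1 - \<eta>)" if "d \<in> D" for d
      using \<eta>\<gamma>[OF that] \<eta> by simp
    have "(\<Sum>d\<in>D. (\<beta> d - \<eta> * \<gamma> d) / (1 - \<eta>)) = (sum \<beta> D - \<eta> * sum \<gamma> D) / (1 - \<eta>)"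
      by (simp add: sum_divide_distrib[symmetric] sum_subtractf sum_distrib_left)
    moreover have "0 \<le> \<eta> * sum \<gamma> D"
      using \<eta> \<gamma>(1) by (intro mult_nonneg_nonneg sum_nonneg) (auto intro: less_imp_le)
    ultimately show "(\<Sum>d\<in>D. (\<beta> d - \<eta> * \<gamma> d) / (1 - \<eta>)) + \<epsilon> / (1 - \<eta>) + 0 \<le> 1"
      using \<eta> by (simp add: field_simps)
  qed (use \<epsilon> \<eta> in auto)
  also have "(\<Sum>d\<in>D. ((\<beta> d - \<eta> * \<gamma> d) / (1 - \<eta>)) *\<^sub>R d) = (1 / (1 - \<eta>)) *\<^sub>R (SB - \<eta> *\<^sub>R SG)"
    by (simp add: SB_def SG_def scaleR_sum_right sum_subtractf[symmetric] algebra_simps diff_divide_distrib)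
  finally have "y \<in> P" by (simp add: y_def)
  then have "y - \<eta> *\<^sub>R (y - c) \<in> interior P"
    using c \<eta> by (intro mem_interior_convex_shrink[OF convex_P]) (auto simp: c_def)
  also have "y - \<eta> *\<^sub>R (y - c) = (1 - \<eta>) *\<^sub>R y + \<eta> *\<^sub>R c"
    by (simp add: algebra_simps)
  also have "(1 - \<eta>) *\<^sub>R y = (1 - \<eta>) *\<^sub>R a + (SB - \<eta> *\<^sub>R SG) + \<epsilon> *\<^sub>R (w - a)"
    using \<eta> unfolding y_def scaleR_add_right by simp
  also have "\<dots> + \<eta> *\<^sub>R c = a + SB + \<epsilon> *\<^sub>R (w - a) + (\<eta> * \<tau>) *\<^sub>R u"
    unfolding c_def SG_def[symmetric] by (simp add: algebra_simps)
  finally show ?thesis unfolding SB_def by blast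
qed

text \<open>Shifting the weight of \<open>a\<close> gradually to \<open>a + L *\<^sub>R u\<close>
  sweeps out a segment parallel to \<open>u\<close> inside \<open>P\<close>, whose length is that
  weight times \<open>L\<close>. It lies on the line through the lattice point and starts at offset
  \<open>- \<tau>\<close>, so \<open>fibre\<close> applies.\<close>

lemma weight_le:
  assumes z: "a + (\<Sum>d\<in>D. \<beta> d *\<^sub>R d) + \<epsilon> *\<^sub>R (w - a) + \<tau> *\<^sub>R u \<in> lattice"
    and w: "w \<in> P" and \<beta>: "\<And>d. d \<in> D \<Longrightarrow> 0 < \<beta> d" and \<epsilon>: "0 \<le> \<epsilon>" and less1: "sum \<beta> D + \<epsilon> < 1"
  shows "(1 - sum \<beta> D - \<epsilon>) * L \<le> K \<and> ((1 - sum \<beta> D - \<epsilon>) * L = K \<longrightarrow> \<tau> \<in> \<int>)"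
proof -
  define y where "y = a + (\<Sum>d\<in>D. \<beta> d *\<^sub>R d) + \<epsilon> *\<^sub>R (w - a)"
  obtain \<kappa> where \<kappa>: "y + \<kappa> *\<^sub>R u \<in> interior P"
    unfolding y_def using meets_interior[OF w \<beta> \<epsilon> less1] by blast
  have y: "y + (\<mu> * L) *\<^sub>R u \<in> P" if "0 \<le> \<mu>" "\<mu> \<le> 1 - sum \<beta> D - \<epsilon>" for \<mu>
    unfolding y_def using that w \<beta> \<epsilon> by (intro in_P) (auto intro: less_imp_le)
  have shift: "y + \<tau> *\<^sub>R u + (- \<tau> + t) *\<^sub>R u = y + t *\<^sub>R u" for t
    by (simp add: algebra_simps)
  have "(1 - sum \<beta> D - \<epsilon>) * L \<le> K \<and> ((1 - sum \<beta> D - \<epsilon>) * L = K \<longrightarrow> - \<tau> \<in> \<int>)"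
  proof (rule fibre)
    show "y + \<tau> *\<^sub>R u \<in> lattice" using z by (simp add: y_def)
    show "y + \<tau> *\<^sub>R u + (\<kappa> - \<tau>) *\<^sub>R u \<in> interior P"
      using \<kappa> by (simp add: algebra_simps)
    show "y + \<tau> *\<^sub>R u + (- \<tau>) *\<^sub>R u \<in> P"
      using y[of 0] less1 by simp
    show "y + \<tau> *\<^sub>R u + (- \<tau> + (1 - sum \<beta> D - \<epsilon>) * L) *\<^sub>R u \<in> P"
      unfolding shift using less1 by (intro y) auto
  qed
  then show ?thesis by simp
qed

lemma coefficients_zero:
  assumes "(\<Sum>d\<in>D. \<beta> d *\<^sub>R d) + \<tau> *\<^sub>R u = 0"
  shows "(\<forall>d\<in>D. \<beta> d = 0) \<and> \<tau> = 0"
proof -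
  define f where "f = \<beta>(u := \<tau>)"
  have "(\<Sum>d\<in>D. f d *\<^sub>R d) = (\<Sum>d\<in>D. \<beta> d *\<^sub>R d)"
    using indep(1) by (intro sum.cong) (auto simp: f_def)
  then have "(\<Sum>v\<in>insert u D. f v *\<^sub>R v) = 0"
    using assms D(1) indep(1) by (simp add: f_def add.commute)
  then have "\<forall>v\<in>insert u D. f v = 0"
    using indep(2) D(1) by (auto simp: dependent_finite)
  then show ?thesis using indep(1) by (metis f_def fun_upd_apply insert_iff)
qed

text \<open>The multiples of the lattice vector, reduced modulo the \<open>d\<close> and
  \<open>u\<close>, form a bounded set of lattice points. Two of them coincide, and by independence
  the difference of their multipliers clears the denominators.\<close>

lemma common_denominator:
  assumes x: "a + (\<Sum>d\<in>D. \<beta> d *\<^sub>R d) + \<tau> *\<^sub>R u \<in> lattice"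
  obtains M :: nat where "0 < M" "\<And>d. d \<in> D \<Longrightarrow> real M * \<beta> d \<in> \<int>"
proof -
  define y where "y = (\<Sum>d\<in>D. \<beta> d *\<^sub>R d) + \<tau> *\<^sub>R u"
  have y: "y \<in> lattice"
    using lattice_diff[OF x a(1)] by (simp add: y_def add.assoc)
  define f where "f j = (\<Sum>d\<in>D. frac (real j * \<beta> d) *\<^sub>R d) + frac (real j * \<tau>) *\<^sub>R u" for j :: nat
  have f_lattice: "f j \<in> lattice" for j
  proof -
    have "f j = real j *\<^sub>R y - ((\<Sum>d\<in>D. of_int \<lfloor>real j * \<beta> d\<rfloor> *\<^sub>R d) + of_int \<lfloor>real j * \<tau>\<rfloor> *\<^sub>R u)"
      by (simp add: f_def y_def frac_def scaleR_left_diff_distrib scaleR_add_right scaleR_sum_right sum_subtractf)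
    also have "\<dots> \<in> lattice"
      using y u(1) D(2) by (intro lattice_diff lattice_add lattice_sum lattice_scaleR) auto
    finally show ?thesis .
  qed
  have "norm (f j) \<le> (\<Sum>d\<in>D. norm d) + norm u" for j
  proof -
    have frac: "norm (frac t *\<^sub>R v) \<le> norm v" for t and v :: "real^'n"
      using frac_lt_1[of t] frac_ge_0[of t] by (simp add: mult_left_le_one_le)
    show ?thesis
      unfolding f_def by (intro norm_triangle_mono sum_norm_le frac)
  qed
  then have "bounded (range f)" by (auto simp: bounded_iff)
  then have "finite (range f)"
    using finite_lattice_Int[of "range f"] f_lattice by (simp add: Int_absorb2 image_subset_iff)
  then have "\<not> inj f" using finite_imageD infinite_UNIV_nat by blast
  then obtain i j where ij: "i < j" "f i = f j"
    unfolding inj_def by (metis linorder_neqE_nat)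
  have "(\<Sum>d\<in>D. (frac (real j * \<beta> d) - frac (real i * \<beta> d)) *\<^sub>R d) + (frac (real j * \<tau>) - frac (real i * \<tau>)) *\<^sub>R u = f j - f i"
    by (simp add: f_def scaleR_left_diff_distrib sum_subtractf)
  then have eq: "frac (real j * \<beta> d) = frac (real i * \<beta> d)" if "d \<in> D" for d
    using coefficients_zero ij(2) that by fastforce
  show thesis
  proof
    show "0 < j - i" using ij by simp
    fix d assume "d \<in> D"
    have "real (j - i) * \<beta> d = of_int (\<lfloor>real j * \<beta> d\<rfloor> - \<lfloor>real i * \<beta> d\<rfloor>)"
      using eq[OF \<open>d \<in> D\<close>] ij(1) by (simp add: frac_def of_nat_diff algebra_simps)
    then show "real (j - i) * \<beta> d \<in> \<int>" by (metis Ints_of_int)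
  qed
qed

section \<open>Nearly maximal apex weight and the length bound\<close>

text \<open>These are the weights at the points \<open>a + d\<close> of a lattice point over the
  relative interior of the simplex; \<open>a\<close> carries the remaining weight
  \<open>1 - sum \<beta> D\<close>. The offset along \<open>u\<close> is left free.\<close>

definition admissible :: "(real^'n \<Rightarrow> real) \<Rightarrow> bool" where
  "admissible \<beta> \<longleftrightarrow> (\<forall>d\<in>D. 0 < \<beta> d) \<and> sum \<beta> D < 1 \<and> (\<exists>\<tau>. a + (\<Sum>d\<in>D. \<beta> d *\<^sub>R d) + \<tau> *\<^sub>R u \<in> lattice)"

text \<open>If the product were larger, a suitable multiple of the lattice point minus a combination of the
  \<open>a + d\<close> would again be admissible, and it would multiply the weight of \<open>a\<close> by at least two.\<close>
lemma prod_le_complement: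
  assumes adm: "admissible \<beta>"
    and max: "\<And>\<beta>'. admissible \<beta>' \<Longrightarrow> 1 - sum \<beta>' D < 2 * (1 - sum \<beta> D)"
    and I: "I \<subseteq> D" "I \<noteq> {}"
  shows "prod \<beta> I \<le> 1 - sum \<beta> I"
proof (rule ccontr)
  assume large: "\<not> ?thesis"
  obtain \<tau> where \<beta>: "\<And>d. d \<in> D \<Longrightarrow> 0 < \<beta> d" "sum \<beta> D < 1"
    and x: "a + (\<Sum>d\<in>D. \<beta> d *\<^sub>R d) + \<tau> *\<^sub>R u \<in> lattice"
    using adm by (auto simp: admissible_def)
  obtain M :: nat where M: "0 < M" "\<And>d. d \<in> D \<Longrightarrow> real M * \<beta> d \<in> \<int>"
    using common_denominator[OF x] by blast
  \<comment> \<open>The weights over the common denominator \<open>M\<close>, as the natural numbers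
    that \<open>small_lattice_vector\<close> takes.\<close>
  define c where "c d = nat \<lfloor>real M * \<beta> d\<rfloor>" for d
  have c: "real (c d) = real M * \<beta> d" if "d \<in> D" for d
  proof -
    have "0 \<le> real M * \<beta> d" using \<beta>(1)[OF that] by simp
    with M(2)[OF that] show ?thesis by (auto simp: c_def elim: Ints_cases)
  qed
  have finI: "finite I" using I D(1) finite_subset by blast
  obtain i0 where i0: "i0 \<in> I" using I by blast
  have sum_c: "real (sum c I) = real M * sum \<beta> I"
    using I c by (simp add: sum_distrib_left subset_iff)
  have "sum \<beta> I \<le> sum \<beta> D"
    using I D(1) \<beta>(1) by (intro sum_mono2) (auto intro: less_imp_le)
  then have "real (sum c I) < real M"
    unfolding sum_c using M(1) \<beta>(2) by simp
  then have less_M: "sum c I < M" by linarith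
  have "real (M ^ (card I - 1) * (M - sum c I)) = real M ^ card I * (1 - sum \<beta> I)"
  proof -
    have "card I = Suc (card I - 1)" using finI i0 by (metis Suc_pred' card_gt_0_iff empty_iff)
    then have "real M ^ card I = real M ^ (card I - 1) * real M" by (metis power_Suc2)
    then show ?thesis using less_M sum_c by (simp add: of_nat_diff algebra_simps del: of_nat_sum)
  qed
  also have "\<dots> < real M ^ card I * prod \<beta> I"
    using large M(1) by simp
  also have "\<dots> = (\<Prod>d\<in>I. real M * \<beta> d)"
    by (simp add: prod.distrib)
  also have "\<dots> = real (prod c I)"
    using I c by (simp add: subset_iff)
  finally have "M ^ (card I - 1) * (M - sum c I) < prod c I" by linarith
  from small_lattice_vector[OF finI i0 less_M this]
  obtain p :: "real^'n \<Rightarrow> int" where p: "0 < sum p I"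
      "\<And>d. d \<in> I \<Longrightarrow> \<bar>sum p I * int (c d) - int M * p d\<bar> < int (c d)"
    by blast
  define s where "s = real_of_int (sum p I)"
  have s: "1 \<le> s" using p(1) unfolding s_def by linarith
  have s_int: "s \<in> \<int>" unfolding s_def by (rule Ints_of_int)
  define q where "q d = (if d \<in> I then real_of_int (p d) else 0)" for d
  have q_int: "q d \<in> \<int>" for d by (simp add: q_def)
  have sum_q: "sum q D = s"
    using I D(1) unfolding q_def s_def by (simp add: sum.If_cases Int_absorb1)
  \<comment> \<open>The weights of s + 1 times the lattice point minus the sum of \<open>q d\<close>
    times \<open>a + d\<close>. As \<open>q\<close> sums to \<open>s\<close>, the total weight is
    still 1, and the weight of \<open>a\<close> is multiplied by s + 1, which is at least 2.\<close>
  define \<beta>' where "\<beta>' d = (s + 1) * \<beta> d - q d" for d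
  have "sum \<beta>' D = (\<Sum>d\<in>D. (s + 1) * \<beta> d - q d)"
    by (simp add: \<beta>'_def)
  also have "\<dots> = (s + 1) * sum \<beta> D - s"
    by (simp only: sum_subtractf sum_q sum_distrib_left)
  finally have weight': "1 - sum \<beta>' D = (s + 1) * (1 - sum \<beta> D)"
    by (simp add: algebra_simps)
  have "admissible \<beta>'"
    unfolding admissible_def
  proof (intro conjI ballI exI)
    fix d assume d: "d \<in> D"
    show "0 < \<beta>' d"
    proof (cases "d \<in> I")
      case True
      have "real_of_int \<bar>sum p I * int (c d) - int M * p d\<bar> < real_of_int (int (c d))"
        using p(2)[OF True] by (simp only: of_int_less_iff)
      then have "\<bar>s * (real M * \<beta> d) - real M * p d\<bar> < real M * \<beta> d"
        using c[OF d] by (simp add: s_def del: of_int_sum)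
      then have "real M * p d < real M * (s * \<beta> d + \<beta> d)"
        by (simp add: algebra_simps abs_less_iff)
      then have "p d < s * \<beta> d + \<beta> d"
        using M(1) by (simp only: mult_less_cancel_left_pos of_nat_0_less_iff)
      then show ?thesis using True by (simp add: \<beta>'_def q_def algebra_simps)
    next
      case False
      then show ?thesis using \<beta>(1)[OF d] s by (simp add: \<beta>'_def q_def)
    qed
  next
    have "0 < 1 - sum \<beta>' D" unfolding weight' using s \<beta>(2) by simp
    then show "sum \<beta>' D < 1" by linarith
    have "a + (\<Sum>d\<in>D. \<beta>' d *\<^sub>R d) + ((s + 1) * \<tau>) *\<^sub>R u
        = (s + 1) *\<^sub>R (a + (\<Sum>d\<in>D. \<beta> d *\<^sub>R d) + \<tau> *\<^sub>R u) - (s *\<^sub>R a + (\<Sum>d\<in>D. q d *\<^sub>R d))"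
      by (simp add: \<beta>'_def scaleR_left_diff_distrib sum_subtractf scaleR_add_right scaleR_left_distrib scaleR_sum_right)
        (simp add: sum.distrib distrib_right scaleR_left_distrib scaleR_sum_right)?
    also have "\<dots> \<in> lattice"
    proof (rule lattice_diff)
      show "(s + 1) *\<^sub>R (a + (\<Sum>d\<in>D. \<beta> d *\<^sub>R d) + \<tau> *\<^sub>R u) \<in> lattice"
        by (rule lattice_scaleR[OF _ x]) (simp add: s_int)
      show "s *\<^sub>R a + (\<Sum>d\<in>D. q d *\<^sub>R d) \<in> lattice"
        using a(1) D(2) q_int by (intro lattice_add lattice_sum lattice_scaleR s_int) auto
    qed
    finally show "a + (\<Sum>d\<in>D. \<beta>' d *\<^sub>R d) + ((s + 1) * \<tau>) *\<^sub>R u \<in> lattice" .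
  qed
  then have "1 - sum \<beta>' D < 2 * (1 - sum \<beta> D)" by (rule max)
  moreover have "2 * (1 - sum \<beta> D) \<le> (s + 1) * (1 - sum \<beta> D)"
    using s \<beta>(2) by (intro mult_right_mono) auto
  ultimately show False unfolding weight' by linarith
qed

text \<open>The apex weights are bounded by 1 and one of them is positive, so some weight exceeds
  half of the supremum. This is enough because the improvement in \<open>prod_le_complement\<close>
  at least doubles the weight.\<close>

lemma ex_nearly_maximal:
  obtains \<beta> where "admissible \<beta>" "\<And>\<beta>'. admissible \<beta>' \<Longrightarrow> 1 - sum \<beta>' D < 2 * (1 - sum \<beta> D)"
proof -
  define W where "W = (\<lambda>\<beta>. 1 - sum \<beta> D) ` Collect admissible"
  have bdd: "bdd_above W"
  proof (rule bdd_aboveI[of _ 1])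
    fix t assume "t \<in> W"
    then obtain \<beta> where "t = 1 - sum \<beta> D" "\<And>d. d \<in> D \<Longrightarrow> 0 \<le> \<beta> d"
      by (force simp: W_def admissible_def)
    then show "t \<le> 1" by (simp add: sum_nonneg)
  qed
  obtain \<beta>0 where \<beta>0: "admissible \<beta>0"
    using seed unfolding admissible_def by blast
  then have "0 < 1 - sum \<beta>0 D" "1 - sum \<beta>0 D \<in> W" by (auto simp: W_def admissible_def)
  then have pos: "0 < Sup W" using cSup_upper[OF _ bdd] by fastforce
  then have "Sup W / 2 < Sup W" by simp
  then obtain t where t: "t \<in> W" "Sup W / 2 < t"
    using less_cSup_iff[of W "Sup W / 2"] bdd \<open>1 - sum \<beta>0 D \<in> W\<close> by blast
  then obtain \<beta> where \<beta>: "admissible \<beta>" "t = 1 - sum \<beta> D" by (auto simp: W_def)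
  show thesis
  proof (rule that[OF \<beta>(1)])
    fix \<beta>' assume "admissible \<beta>'"
    then have "1 - sum \<beta>' D \<le> Sup W" using bdd by (intro cSup_upper) (auto simp: W_def)
    also have "Sup W < 2 * (1 - sum \<beta> D)" using t(2) \<beta>(2) by simp
    finally show "1 - sum \<beta>' D < 2 * (1 - sum \<beta> D)" .
  qed
qed

text \<open>Listed in decreasing order, nearly maximal weights satisfy the hypotheses of
  \<open>sum_le_sum_inverse_sylv\<close>, by \<open>prod_le_complement\<close> on initial segments.
  So \<open>a\<close> has weight at least \<open>y\<close>, the gap left by the reciprocals, and
  \<open>weight_le\<close> turns this into the bound on \<open>L\<close>.\<close>

lemma length_bound:
  obtains v \<beta> where "bij_betw v {1..card D} D" "admissible \<beta>"
    "L \<le> K * (real (sylv (Suc (card D))) - 1)"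
    "L = K * (real (sylv (Suc (card D))) - 1) \<Longrightarrow> \<forall>i\<in>{1..card D}. \<beta> (v i) = 1 / real (sylv i)"
proof -
  obtain \<beta> where adm: "admissible \<beta>"
    and max: "\<And>\<beta>'. admissible \<beta>' \<Longrightarrow> 1 - sum \<beta>' D < 2 * (1 - sum \<beta> D)"
    using ex_nearly_maximal by blast
  obtain v where v: "bij_betw v {1..card D} D"
    and anti: "\<And>i j. 1 \<le> i \<Longrightarrow> i \<le> j \<Longrightarrow> j \<le> card D \<Longrightarrow> \<beta> (v j) \<le> \<beta> (v i)"
    using decreasing_enumeration[OF D(1), of \<beta>] by blast
  have vD: "v i \<in> D" if "i \<in> {1..card D}" for i
    using v that bij_betwE by blast
  define x where "x i = \<beta> (v i)" for i
  define y where "y = 1 / (real (sylv (Suc (card D))) - 1)"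
  have sum_y: "(\<Sum>i\<in>{1..card D}. 1 / real (sylv i)) = 1 - y"
    unfolding sum_inverse_sylv prod_inverse_sylv y_def ..
  have sum_x: "(\<Sum>i\<in>{1..card D}. x i) = sum \<beta> D"
    unfolding x_def by (rule sum.reindex_bij_betw[OF v])
  have "(\<Prod>i\<in>{1..t}. x i) \<le> 1 - (\<Sum>i\<in>{1..t}. x i)" if t: "t \<in> {1..card D}" for t
  proof -
    have inj: "inj_on v {1..t}" using v t by (auto simp: bij_betw_def intro: inj_on_subset)
    have "prod \<beta> (v ` {1..t}) \<le> 1 - sum \<beta> (v ` {1..t})"
      using t vD by (intro prod_le_complement[OF adm max]) auto
    then show ?thesis unfolding prod.reindex[OF inj] sum.reindex[OF inj] x_def comp_def .
  qed
  then have *: "sum \<beta> D \<le> 1 - y \<and> (sum \<beta> D = 1 - y \<longrightarrow> (\<forall>i\<in>{1..card D}. x i = 1 / real (sylv i)))"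
    using sum_le_sum_inverse_sylv[of "card D" x] anti adm vD
    unfolding sum_x sum_y by (auto simp: x_def admissible_def)
  obtain \<tau> where "a + (\<Sum>d\<in>D. \<beta> d *\<^sub>R d) + 0 *\<^sub>R (a - a) + \<tau> *\<^sub>R u \<in> lattice"
    using adm by (auto simp: admissible_def)
  then have le: "(1 - sum \<beta> D) * L \<le> K"
    using weight_le[of \<beta> 0 a \<tau>] a(2) adm by (auto simp: admissible_def)
  have s: "0 < real (sylv (Suc (card D))) - 1"
    using sylv_ge2[of "Suc (card D)"] by simp
  have "y * L \<le> (1 - sum \<beta> D) * L"
    using * L by (intro mult_right_mono) auto
  with le have yL: "y * L \<le> K" by linarith
  show thesis
  proof (rule that[OF v adm])
    show "L \<le> K * (real (sylv (Suc (card D))) - 1)"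
      using yL s by (simp add: y_def field_simps)
    assume "L = K * (real (sylv (Suc (card D))) - 1)"
    then have "K = y * L" using s by (simp add: y_def)
    then have "1 - sum \<beta> D \<le> y" using le L by simp
    then show "\<forall>i\<in>{1..card D}. \<beta> (v i) = 1 / real (sylv i)"
      using * by (auto simp: x_def)
  qed
qed

end

section \<open>The case of equality\<close>

text \<open>The equivalence is given by the inverse of a parametrisation of \<open>P\<close> by
  \<open>Q\<close>, which is the direction in which explicit coordinates arise.\<close>

lemma unimod_equivI:
  fixes h :: "real^'n \<Rightarrow> real^'n"
  assumes h: "linear h" "surj h"
    and lat: "\<And>y. y \<in> lattice \<longleftrightarrow> a + h y \<in> lattice"
    and Q: "P = (\<lambda>y. a + h y) ` Q"
  shows "unimod_equiv P Q"
proof -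
  obtain g where g: "linear g" "\<And>x. h (g x) = x" "\<And>y. g (h y) = y"
    using linear_surjective_isomorphism[OF h] by blast
  define f where "f = (\<lambda>x. g x + (- g a))"
  have f: "f x = g (x - a)" for x
    by (simp add: f_def linear_diff[OF g(1)])
  have inv: "f (a + h y) = y" "a + h (f x) = x" for x y
    by (simp_all add: f g)
  have "bij f" by (rule o_bij[of "\<lambda>y. a + h y"]) (auto simp: inv)
  moreover have "f ` lattice = lattice"
  proof (intro equalityI subsetI)
    fix y assume "y \<in> f ` lattice"
    then show "y \<in> lattice" using lat inv by force
  next
    fix y :: "real^'n" assume "y \<in> lattice"
    then show "y \<in> f ` lattice" using lat inv by (metis image_eqI)
  qed
  moreover have "f ` P = Q" unfolding Q by (simp add: image_image inv)
  ultimately show ?thesis unfolding unimod_equiv_def using g(1) f_def by blast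
qed

text \<open>The \<open>m d\<close> stand for the Sylvester numbers, of which only positivity,
  coprimality and the reciprocal sum enter. \<open>K_eq\<close> says that the segment through the
  lattice point with weights \<open>1 / real (m d)\<close> attains the bound
  \<open>K\<close>.\<close>

locale extremal_fibred_simplex = fibred_simplex P a u L K D
  for P :: "(real^'n) set" and a u L K D +
  fixes m :: "real^'n \<Rightarrow> nat"
  assumes m_pos: "\<And>d. d \<in> D \<Longrightarrow> 0 < m d"
    and m_coprime: "\<And>d e. d \<in> D \<Longrightarrow> e \<in> D \<Longrightarrow> d \<noteq> e \<Longrightarrow> coprime (m d) (m e)"
    and sum_m: "(\<Sum>d\<in>D. 1 / real (m d)) < 1"
    and K_eq: "(1 - (\<Sum>d\<in>D. 1 / real (m d))) * L = K"
    and centre0: "\<exists>\<tau>. a + (\<Sum>d\<in>D. (1 / real (m d)) *\<^sub>R d) + \<tau> *\<^sub>R u \<in> lattice"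
    and primitive: "\<And>c. c *\<^sub>R u \<in> lattice \<Longrightarrow> c \<in> \<int>"
    and card_D: "card D = CARD('n) - 1"
begin

abbreviation apex_weight :: real where "apex_weight \<equiv> 1 - (\<Sum>d\<in>D. 1 / real (m d))"

lemma inverse_m_pos: "d \<in> D \<Longrightarrow> 0 < 1 / real (m d)"
  using m_pos by simp

text \<open>Here \<open>weight_le\<close> holds with equality, so the offset along \<open>u\<close>
  is an integer and can be subtracted.\<close>

lemma centre: "a + (\<Sum>d\<in>D. (1 / real (m d)) *\<^sub>R d) \<in> lattice"
proof -
  obtain \<tau> where \<tau>: "a + (\<Sum>d\<in>D. (1 / real (m d)) *\<^sub>R d) + 0 *\<^sub>R (a - a) + \<tau> *\<^sub>R u \<in> lattice"
    using centre0 by auto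
  then have "\<tau> \<in> \<int>"
    using weight_le[OF \<tau> a(2) inverse_m_pos] sum_m K_eq by simp
  then show ?thesis
    using lattice_diff[OF \<tau> lattice_scaleR[OF _ u(1)], of \<tau>] by simp
qed

text \<open>By the Chinese remainder theorem some \<open>j\<close> is 1 modulo \<open>m d\<close>
  and 0 modulo every other \<open>m e\<close>. Then \<open>j\<close> times the vector from
  \<open>a\<close> to the centre is the claimed vector plus an integral combination of
  \<open>D\<close>.\<close>

lemma unit_vector: 
  assumes d: "d \<in> D"
  shows "(1 / real (m d)) *\<^sub>R d \<in> lattice"
proof -
  define t where "t e = (if e = d then 1 else 0 :: nat)" for e
  have "\<exists>j. \<forall>e\<in>D. [j = t e] (mod m e)"
    using D(1) m_coprime by (intro chinese_remainder_nat) auto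
  then obtain j where j: "\<And>e. e \<in> D \<Longrightarrow> [j = t e] (mod m e)" by blast
  define q where "q e = (real j - real (t e)) / real (m e)" for e
  have q: "q e \<in> \<int>" if "e \<in> D" for e
  proof -
    have "[int j = int (t e)] (mod int (m e))"
      using j[OF that] by (simp add: cong_int_iff)
    then obtain k where "int j - int (t e) = int (m e) * k"
      by (metis cong_iff_dvd_diff dvdE)
    then have "real j - real (t e) = real (m e) * of_int k"
      by (metis of_int_diff of_int_mult of_int_of_nat_eq)
    then show ?thesis using m_pos[OF that] by (simp add: q_def)
  qed
  define y where "y = (\<Sum>e\<in>D. (1 / real (m e)) *\<^sub>R e)"
  have y: "y \<in> lattice" using lattice_diff[OF centre a(1)] by (simp add: y_def)
  have "real j *\<^sub>R y - (\<Sum>e\<in>D. q e *\<^sub>R e) = (\<Sum>e\<in>D. (real (t e) / real (m e)) *\<^sub>R e)"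
    unfolding y_def scaleR_sum_right sum_subtractf[symmetric]
    by (intro sum.cong refl) (simp add: q_def scaleR_left_diff_distrib[symmetric] diff_divide_distrib)
  also have "\<dots> = (\<Sum>e\<in>D. if e = d then (1 / real (m d)) *\<^sub>R d else 0)"
    by (intro sum.cong refl) (simp add: t_def)
  also have "\<dots> = (1 / real (m d)) *\<^sub>R d"
    using d D(1) by simp
  finally have eq: "(1 / real (m d)) *\<^sub>R d = real j *\<^sub>R y - (\<Sum>e\<in>D. q e *\<^sub>R e)" ..
  show ?thesis
    unfolding eq using y q D(2) by (intro lattice_diff lattice_sum lattice_scaleR) auto
qed

lemma ex_coordinates:
  obtains \<gamma> \<tau> where "y = (\<Sum>d\<in>D. \<gamma> d *\<^sub>R d) + \<tau> *\<^sub>R u"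
proof -
  have "card (insert u D) = CARD('n)"
    using card_D D(1) indep(1) zero_less_card_finite[where 'a = 'n] by simp
  then have "span (insert u D) = UNIV"
    using card_eq_dim[of "insert u D" UNIV] indep(2) D(1) by (simp add: dim_UNIV) blast
  then have "y \<in> span (insert u D)" by simp
  then obtain f where "y = (\<Sum>v\<in>insert u D. f v *\<^sub>R v)"
    using D(1) by (auto simp: span_finite)
  then have "y = (\<Sum>d\<in>D. f d *\<^sub>R d) + f u *\<^sub>R u"
    using D(1) indep(1) by (simp add: add.commute)
  then show thesis by (rule that)
qed

text \<open>Translation by the vectors of \<open>unit_vector\<close> moves the weights into (0, 1 /
  m d]. The apex weight is then at least that of the centre, and \<open>weight_le\<close> excludes
  anything larger, so all weights are \<open>1 / real (m d)\<close>. What remains is a multiple of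
  \<open>u\<close>, handled by primitivity.\<close>

lemma lattice_coordinates:
  assumes z: "a + (\<Sum>d\<in>D. \<gamma> d *\<^sub>R d) + \<tau> *\<^sub>R u \<in> lattice"
  shows "(\<forall>d\<in>D. real (m d) * \<gamma> d \<in> \<int>) \<and> \<tau> \<in> \<int>"
proof -
  \<comment> \<open>Rounding up makes the interval for \<open>\<beta> d\<close> open at 0, as
    \<open>weight_le\<close> asks for strictly positive weights.\<close>
  define c where "c d = real_of_int \<lceil>real (m d) * \<gamma> d\<rceil>" for d
  define \<beta> where "\<beta> d = 1 / real (m d) + \<gamma> d - c d / real (m d)" for d
  have \<beta>_pos: "0 < \<beta> d" if "d \<in> D" for d
  proof -
    have "0 < (real (m d) * \<gamma> d + 1 - c d) / real (m d)"
      unfolding c_def using m_pos[OF that] by (intro divide_pos_pos) (linarith, simp)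
    also have "\<dots> = \<beta> d" using m_pos[OF that] by (simp add: \<beta>_def add_divide_distrib diff_divide_distrib)
    finally show ?thesis .
  qed
  have \<beta>_le: "\<beta> d \<le> 1 / real (m d)" if "d \<in> D" for d
  proof -
    have "real (m d) * \<gamma> d / real (m d) \<le> c d / real (m d)"
      unfolding c_def by (intro divide_right_mono) auto
    then show ?thesis using m_pos[OF that] by (simp add: \<beta>_def)
  qed
  have unit_sum: "(\<Sum>d\<in>D. (c d / real (m d)) *\<^sub>R d) \<in> lattice"
  proof (rule lattice_sum)
    fix d assume "d \<in> D"
    then show "(c d / real (m d)) *\<^sub>R d \<in> lattice"
      using lattice_scaleR[OF _ unit_vector, of "c d" d] by (simp add: c_def)
  qed
  have "a + (\<Sum>d\<in>D. \<beta> d *\<^sub>R d) + 0 *\<^sub>R (a - a) + \<tau> *\<^sub>R u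
      = (a + (\<Sum>d\<in>D. (1 / real (m d)) *\<^sub>R d)) + ((a + (\<Sum>d\<in>D. \<gamma> d *\<^sub>R d) + \<tau> *\<^sub>R u) - a)
        - (\<Sum>d\<in>D. (c d / real (m d)) *\<^sub>R d)"
    by (simp add: \<beta>_def scaleR_left_diff_distrib scaleR_left_distrib sum.distrib sum_subtractf)
  also have "\<dots> \<in> lattice"
    by (rule lattice_diff[OF lattice_add[OF centre lattice_diff[OF z a(1)]] unit_sum])
  finally have lat: "a + (\<Sum>d\<in>D. \<beta> d *\<^sub>R d) + 0 *\<^sub>R (a - a) + \<tau> *\<^sub>R u \<in> lattice" .
  have sum_le: "sum \<beta> D \<le> (\<Sum>d\<in>D. 1 / real (m d))"
    using \<beta>_le by (rule sum_mono)
  have "(1 - sum \<beta> D) * L \<le> apex_weight * L"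
    using weight_le[OF lat a(2) \<beta>_pos] sum_le sum_m K_eq by simp
  then have "sum \<beta> D = (\<Sum>d\<in>D. 1 / real (m d))" using L sum_le by simp
  then have "(\<Sum>d\<in>D. 1 / real (m d) - \<beta> d) = 0" by (simp add: sum_subtractf)
  then have eq: "\<forall>d\<in>D. 1 / real (m d) - \<beta> d = 0"
    using \<beta>_le D(1) by (subst (asm) sum_nonneg_eq_0_iff) auto
  have eq': "real (m d) * \<gamma> d = c d" if "d \<in> D" for d
    using eq that m_pos[OF that] by (auto simp: \<beta>_def field_simps)
  have "(\<Sum>d\<in>D. (c d / real (m d)) *\<^sub>R d) = (\<Sum>d\<in>D. \<gamma> d *\<^sub>R d)"
  proof (rule sum.cong)
    fix d assume "d \<in> D"
    then have "c d / real (m d) = \<gamma> d" using eq'[of d] m_pos[of d] by (simp add: field_simps)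
    then show "(c d / real (m d)) *\<^sub>R d = \<gamma> d *\<^sub>R d" by simp
  qed simp
  then have "\<tau> *\<^sub>R u = (a + (\<Sum>d\<in>D. \<gamma> d *\<^sub>R d) + \<tau> *\<^sub>R u) - a - (\<Sum>d\<in>D. (c d / real (m d)) *\<^sub>R d)"
    by simp
  also have "\<dots> \<in> lattice" by (rule lattice_diff[OF lattice_diff[OF z a(1)] unit_sum])
  finally have "\<tau> \<in> \<int>" by (rule primitive)
  then show ?thesis using eq' by (metis Ints_of_int c_def)
qed

text \<open>A point of \<open>P\<close> outside the simplex, mixed in with small weight \<open>\<epsilon>\<close>, would lengthen the fibre through
  the centre or through a neighbouring lattice point beyond \<open>K\<close>.\<close>
lemma coordinates_of_P:
  assumes wP: "w \<in> P" and w: "w = a + (\<Sum>d\<in>D. \<omega> d *\<^sub>R d) + \<tau> *\<^sub>R u"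
  shows "(\<forall>d\<in>D. 0 \<le> \<omega> d) \<and> sum \<omega> D \<le> 1 \<and> 0 \<le> \<tau> \<and> \<tau> \<le> (1 - sum \<omega> D) * L"
proof -
  \<comment> \<open>Mixing in \<open>w\<close> with weight \<epsilon> and subtracting
    \<open>\<epsilon> * \<omega> d\<close> from the weights leaves the point unchanged modulo
    \<open>u\<close>, while the weight of \<open>a\<close> grows by
    \<open>\<epsilon> * (sum \<omega> D - 1)\<close>.\<close>
  have mix: "a + (\<Sum>d\<in>D. (\<beta> d - \<epsilon> * \<omega> d) *\<^sub>R d) + \<epsilon> *\<^sub>R (w - a) + t *\<^sub>R u
      = a + (\<Sum>d\<in>D. \<beta> d *\<^sub>R d) + (t + \<epsilon> * \<tau>) *\<^sub>R u" for \<beta> \<epsilon> t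
    by (simp add: w scaleR_left_diff_distrib scaleR_left_distrib scaleR_add_right sum_subtractf scaleR_sum_right)
  have mix_sum: "(\<Sum>d\<in>D. \<beta> d - \<epsilon> * \<omega> d) = sum \<beta> D - \<epsilon> * sum \<omega> D" for \<beta> \<epsilon>
    by (simp add: sum_subtractf sum_distrib_left)
  have no_gain: "1 - sum \<beta> D + \<epsilon> * (sum \<omega> D - 1) \<le> apex_weight"
    if lat: "a + (\<Sum>d\<in>D. \<beta> d *\<^sub>R d) \<in> lattice" and pos: "\<And>d. d \<in> D \<Longrightarrow> 0 < \<beta> d - \<epsilon> * \<omega> d"
      and \<epsilon>: "0 \<le> \<epsilon>" and w1: "0 < 1 - sum \<beta> D + \<epsilon> * (sum \<omega> D - 1)" for \<beta> \<epsilon>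
  proof -
    have "a + (\<Sum>d\<in>D. (\<beta> d - \<epsilon> * \<omega> d) *\<^sub>R d) + \<epsilon> *\<^sub>R (w - a) + (- \<epsilon> * \<tau>) *\<^sub>R u \<in> lattice"
      unfolding mix using lat by simp
    from weight_le[OF this wP pos \<epsilon>]
    have "(1 - sum \<beta> D + \<epsilon> * (sum \<omega> D - 1)) * L \<le> apex_weight * L"
      using w1 K_eq by (simp add: mix_sum algebra_simps)
    then show ?thesis using L by simp
  qed
  have nonneg: "0 \<le> \<omega> e" if e: "e \<in> D" for e
  proof (rule ccontr)
    assume neg: "\<not> 0 \<le> \<omega> e"
    \<comment> \<open>The lattice point next to the centre with weight 0 at \<open>e\<close>. Mixing
      in \<open>w\<close> makes that weight positive because \<open>\<omega> e\<close> is negative,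
      and \<open>a\<close> has gained \<open>1 / real (m e)\<close>.\<close>
    define \<beta> where "\<beta> d = (if d = e then 0 else 1 / real (m d))" for d
    have "a + (\<Sum>d\<in>D. \<beta> d *\<^sub>R d) = (a + (\<Sum>d\<in>D. (1 / real (m d)) *\<^sub>R d)) - (1 / real (m e)) *\<^sub>R e"
    proof -
      have "(\<Sum>d\<in>D. \<beta> d *\<^sub>R d) = (\<Sum>d\<in>D - {e}. (1 / real (m d)) *\<^sub>R d)"
        using e D(1) by (simp add: sum.remove[of D e] \<beta>_def)
      then show ?thesis using e D(1) by (simp add: sum.remove[of D e "\<lambda>d. (1 / real (m d)) *\<^sub>R d"])
    qed
    also have "\<dots> \<in> lattice" using centre unit_vector[OF e] by (rule lattice_diff)
    finally have lat: "a + (\<Sum>d\<in>D. \<beta> d *\<^sub>R d) \<in> lattice" .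
    have sum_\<beta>: "sum \<beta> D = (\<Sum>d\<in>D. 1 / real (m d)) - 1 / real (m e)"
      using e D(1) by (simp add: sum.remove[of D e] \<beta>_def)
    obtain \<epsilon>0 where \<epsilon>0: "0 < \<epsilon>0" "\<epsilon>0 < 1" "\<And>d. d \<in> D - {e} \<Longrightarrow> \<epsilon>0 * \<omega> d < 1 / real (m d)"
      using ex_small_multiplier[of "D - {e}" "\<lambda>d. 1 / real (m d)" \<omega>] D(1) inverse_m_pos by blast
    define i where "i = 1 / real (m e)"
    have i: "0 < i" using inverse_m_pos[OF e] by (simp add: i_def)
    define T where "T = \<bar>sum \<omega> D - 1\<bar> + 1"
    have T: "0 < T" "\<bar>sum \<omega> D - 1\<bar> \<le> T" by (auto simp: T_def)
    \<comment> \<open>The second bound keeps the change of the apex weight caused by the mixing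
      below half of the gain \<open>i\<close>.\<close>
    define \<epsilon> where "\<epsilon> = min \<epsilon>0 (i / (2 * T))"
    have \<epsilon>: "0 < \<epsilon>" "\<epsilon> \<le> \<epsilon>0" using \<epsilon>0 i T by (auto simp: \<epsilon>_def)
    have "\<epsilon> * \<bar>sum \<omega> D - 1\<bar> \<le> (i / (2 * T)) * T"
      using T i by (intro mult_mono) (auto simp: \<epsilon>_def)
    also have "\<dots> = i / 2"
      using T by simp
    finally have small: "\<epsilon> * \<bar>sum \<omega> D - 1\<bar> \<le> i / 2" .
    define X where "X = \<epsilon> * (sum \<omega> D - 1)"
    have "\<bar>X\<bar> \<le> i / 2"
      using small \<epsilon>(1) by (simp add: X_def abs_mult)
    then have "- (i) < X" using i by linarith
    then have gain: "1 - sum \<beta> D + \<epsilon> * (sum \<omega> D - 1) > apex_weight"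
      unfolding sum_\<beta> X_def[symmetric] i_def[symmetric] by linarith
    moreover have "1 - sum \<beta> D + \<epsilon> * (sum \<omega> D - 1) \<le> apex_weight"
    proof (rule no_gain[OF lat])
      fix d assume d: "d \<in> D"
      show "0 < \<beta> d - \<epsilon> * \<omega> d"
      proof (cases "d = e")
        case True
        then show ?thesis using neg \<epsilon>(1) by (simp add: \<beta>_def mult_pos_neg)
      next
        case False
        have "\<epsilon> * \<omega> d \<le> max 0 (\<epsilon>0 * \<omega> d)"
        proof (cases "0 \<le> \<omega> d")
          case True
          then show ?thesis using mult_right_mono[OF \<epsilon>(2) True] by simp
        next
          case False
          then have "\<epsilon> * \<omega> d \<le> 0" using \<epsilon>(1) by (intro mult_nonneg_nonpos) auto
          then show ?thesis by simp
        qed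
        also have "\<dots> < 1 / real (m d)" using \<epsilon>0(3) d False inverse_m_pos[OF d] by auto
        finally show ?thesis using False by (simp add: \<beta>_def)
      qed
    qed (use \<epsilon> gain sum_m in linarith)+
    ultimately show False by linarith
  qed
  define \<beta> where "\<beta> d = 1 / real (m d)" for d
  have lat: "a + (\<Sum>d\<in>D. \<beta> d *\<^sub>R d) \<in> lattice" using centre by (simp add: \<beta>_def)
  have \<beta>_pos: "0 < \<beta> d" if "d \<in> D" for d using inverse_m_pos[OF that] by (simp add: \<beta>_def)
  obtain \<epsilon>0 where \<epsilon>0: "0 < \<epsilon>0" "\<epsilon>0 < 1" "\<And>d. d \<in> D \<Longrightarrow> \<epsilon>0 * \<omega> d < \<beta> d"
    using ex_small_multiplier[of D \<beta> \<omega>] D(1) \<beta>_pos by blast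
  have l0: "1 - sum \<beta> D = apex_weight" by (simp add: \<beta>_def)
  have sum_le: "sum \<omega> D \<le> 1"
  proof (rule ccontr)
    assume "\<not> ?thesis"
    \<comment> \<open>With \<open>sum \<omega> D\<close> above 1, mixing \<open>w\<close> into the
      centre itself would raise the apex weight.\<close>
    then have pos: "0 < \<epsilon>0 * (sum \<omega> D - 1)" using \<epsilon>0 by simp
    have "1 - sum \<beta> D + \<epsilon>0 * (sum \<omega> D - 1) \<le> apex_weight"
    proof (rule no_gain[OF lat])
      show "0 < \<beta> d - \<epsilon>0 * \<omega> d" if "d \<in> D" for d using \<epsilon>0(3)[OF that] by simp
      show "0 \<le> \<epsilon>0" using \<epsilon>0 by simp
      show "0 < 1 - sum \<beta> D + \<epsilon>0 * (sum \<omega> D - 1)" using pos l0 sum_m by linarith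
    qed
    then show False using pos l0 by linarith
  qed
  define \<epsilon> where "\<epsilon> = min \<epsilon>0 apex_weight"
  have \<epsilon>: "0 < \<epsilon>" "\<epsilon> < 1" "\<epsilon> \<le> apex_weight" using \<epsilon>0 sum_m by (auto simp: \<epsilon>_def)
  have \<epsilon>_\<omega>: "\<epsilon> * \<omega> d \<le> \<beta> d" if "d \<in> D" for d
    using mult_right_mono[of \<epsilon> \<epsilon>0 "\<omega> d"] nonneg[OF that] \<epsilon>0(3)[OF that] by (simp add: \<epsilon>_def)
  define x where "x = a + (\<Sum>d\<in>D. \<beta> d *\<^sub>R d)"
  \<comment> \<open>The weight of \<open>a\<close> left at the centre after mixing in
    \<open>w\<close>; \<open>\<epsilon> \<le> apex_weight\<close> keeps it nonnegative.\<close>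
  define \<mu> where "\<mu> = apex_weight - \<epsilon> * (1 - sum \<omega> D)"
  have "\<epsilon> * (1 - sum \<omega> D) \<le> \<epsilon> * 1"
    using \<epsilon> nonneg by (intro mult_left_mono) (auto simp: sum_nonneg)
  then have \<mu>: "0 \<le> \<mu>" using \<epsilon>(3) unfolding \<mu>_def by linarith
  have mixP: "x + (t * L + \<epsilon> * \<tau>) *\<^sub>R u \<in> P" if t: "0 \<le> t" "t \<le> \<mu>" for t
  proof -
    have "a + (\<Sum>d\<in>D. (\<beta> d - \<epsilon> * \<omega> d) *\<^sub>R d) + \<epsilon> *\<^sub>R (w - a) + (t * L) *\<^sub>R u \<in> P"
    proof (rule in_P[OF wP])
      show "(\<Sum>d\<in>D. \<beta> d - \<epsilon> * \<omega> d) + \<epsilon> + t \<le> 1"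
        unfolding mix_sum using t l0 by (simp add: \<mu>_def algebra_simps)
    qed (use \<epsilon> \<epsilon>_\<omega> t in auto)
    then show ?thesis unfolding mix x_def .
  qed
  have xP: "x + (t * L) *\<^sub>R u \<in> P" if t: "0 \<le> t" "t \<le> apex_weight" for t
    using in_P[OF a(2), of \<beta> 0 t] \<beta>_pos t l0 by (auto simp: x_def intro: less_imp_le)
  obtain \<kappa> where \<kappa>: "x + \<kappa> *\<^sub>R u \<in> interior P"
    using meets_interior[OF a(2), of \<beta> 0] \<beta>_pos sum_m l0 by (auto simp: x_def)
  have x_lat: "x \<in> lattice" using lat by (simp add: x_def)
  \<comment> \<open>The line through the centre meets \<open>P\<close> in the segment from 0 to
    \<open>apex_weight * L\<close>, already of length \<open>K\<close>, and in one from
    \<open>\<epsilon> * \<tau>\<close> to \<open>\<mu> * L + \<epsilon> * \<tau>\<close>. Neither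
    may reach beyond the other: the lower ends give this inequality, the upper ends the next
    one.\<close>
  have "0 \<le> \<tau>"
  proof -
    have "apex_weight * L - \<epsilon> * \<tau> \<le> K"
      using fibre[OF x_lat \<kappa>, of "\<epsilon> * \<tau>" "apex_weight * L - \<epsilon> * \<tau>"] mixP[of 0] xP[of apex_weight] \<mu> sum_m by simp
    then show ?thesis using K_eq \<epsilon>(1) by (simp add: zero_le_mult_iff)
  qed
  moreover have "\<tau> \<le> (1 - sum \<omega> D) * L"
  proof -
    have "\<mu> * L + \<epsilon> * \<tau> \<le> K"
      using fibre[OF x_lat \<kappa>, of 0 "\<mu> * L + \<epsilon> * \<tau>"] mixP[of \<mu>] xP[of 0] \<mu> sum_m by simp
    also have "K = \<mu> * L + \<epsilon> * ((1 - sum \<omega> D) * L)"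
      using K_eq by (simp add: \<mu>_def algebra_simps)
    finally show ?thesis using \<epsilon>(1) by simp
  qed
  ultimately show ?thesis using nonneg sum_le by blast
qed

text \<open>By \<open>coordinates_of_P\<close>, every point of \<open>P\<close> has nonnegative
  weights: \<omega> at the \<open>a + d\<close>, \<open>\<tau> / L\<close> at
  \<open>a + L *\<^sub>R u\<close>, and the rest at \<open>a\<close>.\<close>

lemma P_eq: "P = convex hull (insert a (insert (a + L *\<^sub>R u) ((+) a ` D)))"
  (is "P = convex hull ?V")
proof
  show "convex hull ?V \<subseteq> P"
    using a(2) b D(3) convex_P by (intro hull_minimal) auto
  show "P \<subseteq> convex hull ?V"
  proof
    fix w assume wP: "w \<in> P"
    obtain \<omega> \<tau> where "w - a = (\<Sum>d\<in>D. \<omega> d *\<^sub>R d) + \<tau> *\<^sub>R u" by (rule ex_coordinates)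
    then have w: "w = a + (\<Sum>d\<in>D. \<omega> d *\<^sub>R d) + \<tau> *\<^sub>R u" by (simp add: algebra_simps)
    note c = coordinates_of_P[OF wP w]
    have "a + (\<Sum>d\<in>D. \<omega> d *\<^sub>R d) + 0 *\<^sub>R (a - a) + (\<tau> / L) *\<^sub>R (a + L *\<^sub>R u - a) \<in> convex hull ?V"
      using c L D(1)
      by (intro convex_combination_from_vertex) (auto simp: hull_inc field_simps)
    then show "w \<in> convex hull ?V" using L by (simp add: w)
  qed
qed

text \<open>The vectors \<open>(1 / real (m d)) *\<^sub>R d\<close> together with \<open>u\<close>
  form a lattice basis, by \<open>unit_vector\<close> and \<open>lattice_coordinates\<close>. The
  map \<open>h\<close> sends the unit vectors to this basis, with \<open>\<rho>0\<close> as the axis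
  of \<open>u\<close>.\<close>

lemma unimod_equiv_standard:
  assumes \<rho>: "inj_on \<rho> D" "\<rho>0 \<notin> \<rho> ` D"
  shows "unimod_equiv P (convex hull (insert 0 (insert (L *\<^sub>R axis \<rho>0 1) ((\<lambda>d. real (m d) *\<^sub>R axis (\<rho> d) 1) ` D))))"
    (is "unimod_equiv P (convex hull ?V)")
proof (rule unimod_equivI)
  define h where "h y = (\<Sum>d\<in>D. (y $ \<rho> d / real (m d)) *\<^sub>R d) + (y $ \<rho>0) *\<^sub>R u" for y :: "real^'n"
  show lin: "linear h"
    unfolding h_def
    by (rule linearI) (simp_all add: add_divide_distrib scaleR_left_distrib sum.distrib scaleR_add_right scaleR_sum_right)
  have preimage: "\<exists>y. h y = (\<Sum>d\<in>D. \<gamma> d *\<^sub>R d) + \<tau> *\<^sub>R u" for \<gamma> \<tau>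
  proof
    define y :: "real^'n" where "y = (\<chi> i. if i = \<rho>0 then \<tau> else real (m (inv_into D \<rho> i)) * \<gamma> (inv_into D \<rho> i))"
    have "(\<Sum>d\<in>D. (y $ \<rho> d / real (m d)) *\<^sub>R d) = (\<Sum>d\<in>D. \<gamma> d *\<^sub>R d)"
      using \<rho> m_pos by (intro sum.cong) (auto simp: y_def)
    then show "h y = (\<Sum>d\<in>D. \<gamma> d *\<^sub>R d) + \<tau> *\<^sub>R u"
      by (simp add: h_def) (simp add: y_def)
  qed
  show "surj h"
    unfolding surj_def
  proof
    fix y
    obtain \<gamma> \<tau> where "y = (\<Sum>d\<in>D. \<gamma> d *\<^sub>R d) + \<tau> *\<^sub>R u" by (rule ex_coordinates)
    then show "\<exists>x. y = h x" using preimage[of \<gamma> \<tau>] by metis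
  qed
  have UNIV_eq: "i = \<rho>0 \<or> i \<in> \<rho> ` D" for i
  proof -
    have "card (insert \<rho>0 (\<rho> ` D)) = CARD('n)"
      using \<rho> D(1) card_D zero_less_card_finite[where 'a = 'n] by (simp add: card_image)
    then have "insert \<rho>0 (\<rho> ` D) = UNIV" by (simp add: card_subset_eq)
    then show ?thesis by blast
  qed
  show "y \<in> lattice \<longleftrightarrow> a + h y \<in> lattice" for y
  proof
    assume y: "y \<in> lattice"
    have "(y $ \<rho> d / real (m d)) *\<^sub>R d \<in> lattice" if "d \<in> D" for d
      using lattice_scaleR[OF _ unit_vector[OF that], of "y $ \<rho> d"] y by (simp add: lattice_def)
    moreover have "y $ \<rho>0 \<in> \<int>" using y by (simp add: lattice_def)
    ultimately show "a + h y \<in> lattice"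
      unfolding h_def by (intro lattice_add lattice_sum lattice_scaleR[OF _ u(1)] a(1))
  next
    assume "a + h y \<in> lattice"
    then have *: "(\<forall>d\<in>D. real (m d) * (y $ \<rho> d / real (m d)) \<in> \<int>) \<and> y $ \<rho>0 \<in> \<int>"
      unfolding h_def by (intro lattice_coordinates) (simp add: add.assoc)
    have "y $ i \<in> \<int>" for i
      using UNIV_eq[of i] * m_pos by fastforce
    then show "y \<in> lattice" by (simp add: lattice_def)
  qed
  have h0: "h 0 = 0" by (simp add: h_def)
  have hu: "h (t *\<^sub>R axis \<rho>0 1) = t *\<^sub>R u" for t
  proof -
    have "(\<Sum>d\<in>D. ((t *\<^sub>R axis \<rho>0 1 :: real^'n) $ \<rho> d / real (m d)) *\<^sub>R d) = 0"
      using \<rho>(2) by (intro sum.neutral) (auto simp: axis_def)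
    then show ?thesis by (simp add: h_def)
  qed
  have hd: "h (real (m e) *\<^sub>R axis (\<rho> e) 1) = e" if e: "e \<in> D" for e
  proof -
    have "(\<Sum>d\<in>D. ((real (m e) *\<^sub>R axis (\<rho> e) 1 :: real^'n) $ \<rho> d / real (m d)) *\<^sub>R d) = (\<Sum>d\<in>D. if d = e then e else 0)"
      using \<rho>(1) e m_pos[OF e] by (intro sum.cong) (auto simp: axis_def inj_on_def)
    also have "\<dots> = e" using e D(1) by simp
    finally show ?thesis using \<rho>(2) e by (auto simp: h_def axis_def)
  qed
  have "(\<lambda>y. a + h y) ` (convex hull ?V) = (+) a ` h ` (convex hull ?V)" by (simp add: image_image)
  also have "\<dots> = convex hull ((+) a ` h ` ?V)"
    by (simp only: convex_hull_linear_image[OF lin] convex_hull_translation)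
  also have "h ` ?V = insert 0 (insert (L *\<^sub>R u) D)"
    using hd by (simp add: h0 hu image_image)
  finally show "P = (\<lambda>y. a + h y) ` (convex hull ?V)"
    by (simp add: P_eq)
qed

end

section \<open>Longest segments and the simplices \<open>S\<^sup>d\<^sub>k\<close>\<close>

text \<open>With \<open>u\<close> primitive, the lattice points on a line attaining
  \<open>ld P\<close> are integer steps of \<open>u\<close> apart, so the \<open>ld P + 1\<close> of
  them in \<open>P\<close> span at least \<open>ld P\<close> steps.\<close>

lemma longest_segment:
  fixes P :: "(real^'n) set"
  assumes P: "convex P" "bounded P" and L: "1 \<le> ld P"
  obtains a u where "a \<in> lattice" "a \<in> P" "u \<in> lattice" "u \<noteq> 0" "a + of_int (ld P) *\<^sub>R u \<in> P"
    "\<And>c. c *\<^sub>R u \<in> lattice \<Longrightarrow> c \<in> \<int>"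
proof -
  have fin: "finite (P \<inter> lattice)" using P(2) by (rule finite_lattice_Int)
  obtain g where g: "rational_line g" "ld P = int (card (P \<inter> lattice \<inter> g)) - 1"
    using ld_attained[OF fin] by blast
  define A where "A = P \<inter> lattice \<inter> g"
  have card_A: "int (card A) = ld P + 1" using g(2) by (simp add: A_def)
  have finA: "finite A" using fin by (simp add: A_def)
  have "\<not> card A \<le> Suc 0" using card_A L by linarith
  then obtain z1 z2 where z: "z1 \<in> A" "z2 \<in> A" "z1 \<noteq> z2"
    using card_le_Suc0_iff_eq[OF finA] by blast
  have "z2 - z1 \<in> lattice" "z2 - z1 \<noteq> 0" using z by (auto simp: A_def intro: lattice_diff)
  from primitive_vector[OF this] obtain u N where u: "u \<in> lattice" "u \<noteq> 0" "0 < N" "z2 - z1 = N *\<^sub>R u"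
    and prim: "\<And>c. c *\<^sub>R u \<in> lattice \<Longrightarrow> c \<in> \<int>"
    by blast
  obtain p q where pq: "g = affine hull {p, q}"
    using g(1) by (auto simp: rational_line_def)
  have line: "\<exists>s. z = p + s *\<^sub>R (q - p)" if z: "z \<in> g" for z
  proof -
    obtain c s where "z = c *\<^sub>R p + s *\<^sub>R q" "c + s = 1" using z by (auto simp: pq affine_hull_2)
    then have "z = p + s *\<^sub>R (q - p)"
      by (metis (no_types, lifting) add.commute add_diff_cancel_right' diff_add_eq scaleR_left_diff_distrib scaleR_one scaleR_right_diff_distrib)
    then show ?thesis ..
  qed
  define h where "h t = z1 + real_of_int t *\<^sub>R u" for t
  have inj: "inj h" using u(2) by (auto simp: inj_def h_def)
  have "A \<subseteq> range h"
  proof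
    fix x assume x: "x \<in> A"
    obtain s s1 s2 where s: "x = p + s *\<^sub>R (q - p)" "z1 = p + s1 *\<^sub>R (q - p)" "z2 = p + s2 *\<^sub>R (q - p)"
      using line x z unfolding A_def by (metis IntD2)
    define c where "c = (s - s1) / (s2 - s1)"
    have "s1 \<noteq> s2" using z(3) s by auto
    then have c: "s - s1 = c * (s2 - s1)" by (simp add: c_def)
    have "x - z1 = (s - s1) *\<^sub>R (q - p)" unfolding s by (simp add: algebra_simps)
    also have "\<dots> = c *\<^sub>R (z2 - z1)" unfolding c s by (simp add: algebra_simps)
    finally have x': "x - z1 = (c * N) *\<^sub>R u" using u(4) by simp
    have "x - z1 \<in> lattice" using x z by (auto simp: A_def intro: lattice_diff)
    then have "c * N \<in> \<int>" using x' prim by simp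
    then obtain t where "c * N = of_int t" by (auto elim: Ints_cases)
    then have "x = h t" using x' by (simp add: h_def algebra_simps)
    then show "x \<in> range h" by simp
  qed
  define T where "T = h -` A"
  have T: "h ` T = A" using \<open>A \<subseteq> range h\<close> by (auto simp: T_def)
  have finT: "finite T" unfolding T_def using finA inj by (rule finite_vimageI)
  have card_T: "card T = card A" using T inj by (metis card_image inj_on_subset subset_UNIV)
  have T_ne: "T \<noteq> {}" using T z by blast
  have "T \<subseteq> {Min T..Max T}" using finT by auto
  then have "card T \<le> card {Min T..Max T}" by (intro card_mono) auto
  then have len: "ld P \<le> Max T - Min T" using card_A card_T L by simp
  define a where "a = h (Min T)"
  have mem: "h t \<in> P \<inter> lattice" if "t \<in> T" for t using that T by (auto simp: A_def)
  have aP: "a \<in> P" "a \<in> lattice" using mem[OF Min_in[OF finT T_ne]] by (auto simp: a_def)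
  \<comment> \<open>At this point the span is only bounded below by \<open>ld P\<close>; convexity
    shortens the segment to that exact length.\<close>
  define r where "r = real_of_int (ld P) / real_of_int (Max T - Min T)"
  have pos: "0 < real_of_int (Max T - Min T)" using len L by linarith
  have r: "0 \<le> r" "r \<le> 1" using len L pos by (auto simp: r_def)
  have hi: "h (Max T) = a + real_of_int (Max T - Min T) *\<^sub>R u"
    by (simp add: a_def h_def algebra_simps)
  have "(1 - r) *\<^sub>R a + r *\<^sub>R h (Max T) \<in> P"
    using P(1) aP mem[OF Max_in[OF finT T_ne]] r by (intro convexD_alt) auto
  also have "(1 - r) *\<^sub>R a + r *\<^sub>R h (Max T) = a + (r * real_of_int (Max T - Min T)) *\<^sub>R u"
    unfolding hi by (simp only: scaleR_add_right scaleR_left_diff_distrib scaleR_scaleR scaleR_one) simp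
  also have "r * real_of_int (Max T - Min T) = of_int (ld P)" using pos by (simp add: r_def)
  finally show thesis using that aP u prim by blast
qed

section \<open>Interior lattice points and diameters of the standard simplices\<close>

text \<open>Interior lattice points have all coordinates at least 1 and a weighted coordinate sum
  below 1. Ones in the first d - 1 coordinates leave only the slack 1 / N, where N =
  \<open>sylv d - 1\<close>, and this keeps the last coordinate below k + 1.\<close>

lemma interior_lattice_simplexS:
  fixes \<sigma> :: "nat \<Rightarrow> 'n::finite"
  assumes d2: "2 \<le> CARD('n)" and \<sigma>: "bij_betw \<sigma> {1..CARD('n)} UNIV"
    and y: "y \<in> interior (simplexS \<sigma> k)" "y \<in> lattice"
  shows "\<exists>t\<in>{1..k}. y = (\<chi> j. if j = \<sigma> CARD('n) then real t else 1)"
proof -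
  define d where "d = CARD('n)"
  define N where "N = sylv d - 1"
  have N: "0 < N" using sylv_ge2[of d] d2 by (simp add: N_def d_def)
  define c where "c i = (if i = d then real ((k + 1) * N) else real (sylv i))" for i
  have c_pos: "0 < c i" for i using N sylv_pos by (simp add: c_def del: of_nat_mult)
  define H where "H = {y::real^'n. (\<forall>j. 0 \<le> y $ j) \<and> (\<Sum>i\<in>{1..d}. y $ \<sigma> i / c i) \<le> 1}"
  have \<sigma>_eq: "\<sigma> i = \<sigma> i' \<longleftrightarrow> i = i'" if "i \<in> {1..d}" "i' \<in> {1..d}" for i i'
    using inj_on_eq_iff[OF bij_betw_imp_inj_on[OF \<sigma>[folded d_def]] that] .
  have vertex: "c i *\<^sub>R axis (\<sigma> i) 1 \<in> H" if i: "i \<in> {1..d}" for i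
  proof -
    have "(\<Sum>i'\<in>{1..d}. (c i *\<^sub>R axis (\<sigma> i) 1 :: real^'n) $ \<sigma> i' / c i') = (\<Sum>i'\<in>{1..d}. if i' = i then 1 else 0)"
      using \<sigma>_eq i c_pos[of i] by (intro sum.cong) (auto simp: axis_def)
    then show ?thesis using i c_pos[of i] by (auto simp: H_def axis_def)
  qed
  have "convex H"
    unfolding convex_def
  proof (intro ballI allI impI)
    fix x y :: "real^'n" and s t :: real
    assume *: "x \<in> H" "y \<in> H" "0 \<le> s" "0 \<le> t" "s + t = 1"
    have "(\<Sum>i\<in>{1..d}. (s *\<^sub>R x + t *\<^sub>R y) $ \<sigma> i / c i)
        = s * (\<Sum>i\<in>{1..d}. x $ \<sigma> i / c i) + t * (\<Sum>i\<in>{1..d}. y $ \<sigma> i / c i)"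
      by (simp add: sum_distrib_left sum.distrib add_divide_distrib)
    also have "\<dots> \<le> s * 1 + t * 1"
      using * by (intro add_mono mult_left_mono) (auto simp: H_def)
    finally show "s *\<^sub>R x + t *\<^sub>R y \<in> H" using * by (simp add: H_def)
  qed
  moreover have "0 \<in> H" by (simp add: H_def)
  moreover have "real (sylv i) *\<^sub>R axis (\<sigma> i) 1 \<in> H" if "i \<in> {1..<d}" for i
    using vertex[of i] that by (simp add: c_def)
  moreover have "real ((k + 1) * (sylv d - 1)) *\<^sub>R axis (\<sigma> d) 1 \<in> H"
    using vertex[of d] d2 unfolding c_def N_def[symmetric] by (simp add: d_def)
  ultimately have sub: "simplexS \<sigma> k \<subseteq> H"
    unfolding simplexS_def d_def[symmetric] by (intro hull_minimal) auto
  obtain e where e: "0 < e" "ball y e \<subseteq> simplexS \<sigma> k"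
    using y(1) mem_interior by blast
  have near: "y + s *\<^sub>R axis j 1 \<in> H" if "\<bar>s\<bar> < e" for s j
  proof -
    have "dist y (y + s *\<^sub>R axis j 1) = \<bar>s\<bar>" by (simp add: dist_norm norm_axis_1)
    then have "y + s *\<^sub>R axis j 1 \<in> ball y e" using that by simp
    then show ?thesis using e(2) sub by blast
  qed
  have y_ge: "1 \<le> y $ j" for j
  proof -
    have "y + (- e / 2) *\<^sub>R axis j 1 \<in> H" using e(1) by (intro near) simp
    then have "0 \<le> (y + (- e / 2) *\<^sub>R axis j 1) $ j" unfolding H_def by blast
    then have "0 < y $ j" using e(1) by (simp add: axis_def)
    moreover obtain n where "y $ j = of_int n" using y(2) by (auto simp: lattice_def elim: Ints_cases)
    ultimately show ?thesis by simp
  qed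
  have d_in: "d \<in> {1..d}" using d2 by (simp add: d_def)
  have y_sum: "(\<Sum>i\<in>{1..d}. y $ \<sigma> i / c i) < 1"
  proof -
    have "(\<Sum>i\<in>{1..d}. (y + (e / 2) *\<^sub>R axis (\<sigma> d) 1) $ \<sigma> i / c i)
        = (\<Sum>i\<in>{1..d}. y $ \<sigma> i / c i + (if i = d then (e / 2) / c d else 0))"
      using \<sigma>_eq d_in by (intro sum.cong) (auto simp: axis_def add_divide_distrib)
    also have "\<dots> = (\<Sum>i\<in>{1..d}. y $ \<sigma> i / c i) + (e / 2) / c d"
      using d_in by (simp add: sum.distrib)
    finally have "(\<Sum>i\<in>{1..d}. y $ \<sigma> i / c i) + (e / 2) / c d \<le> 1"
      using near[of "e / 2" "\<sigma> d"] e(1) by (simp add: H_def)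
    moreover have "0 < (e / 2) / c d" using e(1) c_pos by simp
    ultimately show ?thesis by linarith
  qed
  have split: "(\<Sum>i\<in>{1..d}. f i) = (\<Sum>i\<in>{1..<d}. f i) + f d" for f :: "nat \<Rightarrow> real"
  proof -
    have "{1..d} = insert d {1..<d}" using d_in by auto
    then show ?thesis by simp
  qed
  have "{1..d - 1} = {1..<d}" "Suc (d - 1) = d" using d_in by auto
  then have sylv_sum: "(\<Sum>i\<in>{1..<d}. 1 / real (sylv i)) = 1 - 1 / real N"
    using sum_inverse_sylv[of "d - 1"] prod_inverse_sylv[of "d - 1"] N by (simp add: N_def of_nat_diff)
  have eq1: "y $ \<sigma> i = 1" if i: "i \<in> {1..<d}" for i
  proof (rule ccontr)
    assume "y $ \<sigma> i \<noteq> 1"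
    moreover obtain n where n: "y $ \<sigma> i = of_int n" using y(2) by (auto simp: lattice_def elim: Ints_cases)
    ultimately have y2: "2 \<le> y $ \<sigma> i" using y_ge[of "\<sigma> i"] by simp
    \<comment> \<open>A second unit in coordinate i costs \<open>1 / real (sylv i)\<close>. Since
      \<open>sylv i\<close> divides \<open>N\<close>, this uses up the whole slack.\<close>
    have "sylv i dvd N" unfolding N_def sylv_minus_one using i by (intro dvd_prodI) auto
    then have "sylv i \<le> N" using N by (rule dvd_imp_le)
    then have le: "1 / real N \<le> 1 / real (sylv i)"
      using sylv_pos[of i] by (intro divide_left_mono) auto
    have "1 - 1 / real N + 1 / real (sylv i) = (\<Sum>i'\<in>{1..<d}. 1 / real (sylv i') + (if i' = i then 1 / real (sylv i) else 0))"
      unfolding sylv_sum[symmetric] using i by (simp add: sum.distrib)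
    also have "\<dots> \<le> (\<Sum>i'\<in>{1..<d}. y $ \<sigma> i' / c i')"
    proof (rule sum_mono)
      fix i' assume i': "i' \<in> {1..<d}"
      have "1 + (if i' = i then 1 else 0) \<le> y $ \<sigma> i'" using y_ge y2 by auto
      then have "(1 + (if i' = i then 1 else 0)) / real (sylv i') \<le> y $ \<sigma> i' / real (sylv i')"
        by (rule divide_right_mono) simp
      then show "1 / real (sylv i') + (if i' = i then 1 / real (sylv i) else 0) \<le> y $ \<sigma> i' / c i'"
        using i' by (auto simp: c_def add_divide_distrib)
    qed
    finally have "1 \<le> (\<Sum>i'\<in>{1..<d}. y $ \<sigma> i' / c i')" using le by linarith
    moreover have "0 < y $ \<sigma> d / c d" using y_ge[of "\<sigma> d"] c_pos[of d] by simp
    ultimately show False using y_sum unfolding split by linarith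
  qed
  have "(\<Sum>i\<in>{1..<d}. y $ \<sigma> i / c i) = 1 - 1 / real N"
    unfolding sylv_sum[symmetric] by (intro sum.cong) (auto simp: eq1 c_def)
  then have "y $ \<sigma> d / c d < 1 / real N" using y_sum unfolding split by linarith
  then have "y $ \<sigma> d < 1 / real N * c d" by (simp only: pos_divide_less_eq[OF c_pos])
  also have "\<dots> = 1 / real N * (real (k + 1) * real N)" by (simp only: c_def if_True of_nat_mult refl)
  finally have less: "y $ \<sigma> d < real (k + 1)" using N by simp
  obtain n where n: "y $ \<sigma> d = of_int n" using y(2) by (auto simp: lattice_def elim: Ints_cases)
  have "1 \<le> n" "n \<le> int k" using y_ge[of "\<sigma> d"] less n by linarith+
  then have t: "nat n \<in> {1..k}" "y $ \<sigma> d = real (nat n)" using n by auto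
  have "y $ j = (if j = \<sigma> d then real (nat n) else 1)" for j
  proof -
    have "j \<in> \<sigma> ` {1..d}" using \<sigma> by (simp add: bij_betw_def d_def)
    then obtain i where "i \<in> {1..d}" "j = \<sigma> i" by blast
    then show ?thesis using t(2) eq1[of i] \<sigma>_eq[of i d] d_in by auto
  qed
  then show ?thesis using t(1) unfolding d_def[symmetric] by (intro bexI[of _ "nat n"]) (auto simp: vec_eq_iff)
qed

text \<open>The edge on the last axis provides the points 0 to (k + 1)(s - 1), s being the last
  Sylvester number. The interior lattice points lie on a segment with \<open>k\<close> lattice
  points; for \<open>k = 0\<close> there are none and the bound is -1.\<close>

lemma ld_of_unimod_equiv_simplexS:
  fixes P :: "(real^'n) set" and \<sigma> :: "nat \<Rightarrow> 'n"
  assumes d2: "2 \<le> CARD('n)" and \<sigma>: "bij_betw \<sigma> {1..CARD('n)} UNIV"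
    and P: "bounded P" and equiv: "unimod_equiv P (simplexS \<sigma> k)"
  shows "int ((k + 1) * (sylv CARD('n) - 1)) \<le> ld P"
    and "ld (convex hull (interior P \<inter> lattice)) \<le> int k - 1"
proof -
  obtain f g b where g: "linear g" and f_def: "f = (\<lambda>x. g x + b)" and f: "bij f"
    "f ` lattice = lattice" "f ` P = simplexS \<sigma> k"
    using equiv by (auto simp: unimod_equiv_def)
  let ?s = "\<sigma> CARD('n)"
  define M where "M = (k + 1) * (sylv CARD('n) - 1)"
  have inj_f: "inj f" using f(1) by (rule bij_is_inj)
  define h where "h = inv f"
  have fh: "f (h y) = y" for y unfolding h_def using f(1) by (simp add: bij_is_surj surj_f_inv_f)
  have h_lat: "h y \<in> lattice" if "y \<in> lattice" for y
    using that f(2) fh inj_f by (metis imageE injD)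
  have h_P: "h y \<in> P" if "y \<in> simplexS \<sigma> k" for y
    using that f(3) fh inj_f by (metis imageE injD)
  have affine: "f ((1 - t) *\<^sub>R x + t *\<^sub>R y) = (1 - t) *\<^sub>R f x + t *\<^sub>R f y" for t x y
    by (simp add: f_def linear_add[OF g] linear_scale[OF g]) (simp add: algebra_simps)
  define p where "p t = h (real t *\<^sub>R axis ?s 1)" for t :: nat
  have inj_p: "inj p"
  proof (rule injI)
    fix t t' assume "p t = p t'"
    then have "real t *\<^sub>R axis ?s 1 = (real t' *\<^sub>R axis ?s 1 :: real^'n)" unfolding p_def by (metis fh)
    then show "t = t'" by (simp add: axis_eq_0_iff)
  qed
  have p_lat: "p t \<in> lattice" for t
    unfolding p_def by (intro h_lat lattice_scaleR axis_in_lattice) simp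
  have p_P: "p t \<in> P" if t: "t \<le> M" for t
  proof -
    have "0 \<in> simplexS \<sigma> k" "real M *\<^sub>R axis ?s 1 \<in> simplexS \<sigma> k"
      unfolding simplexS_def M_def by (auto intro: hull_inc)
    moreover have "convex (simplexS \<sigma> k)" by (simp add: simplexS_def)
    ultimately have *: "(1 - real t / real M) *\<^sub>R 0 + (real t / real M) *\<^sub>R (real M *\<^sub>R axis ?s 1) \<in> simplexS \<sigma> k"
      using t by (intro convexD_alt) (auto simp: divide_le_eq)
    have "real t *\<^sub>R axis ?s 1 \<in> simplexS \<sigma> k"
    proof (cases "M = 0")
      case True
      then show ?thesis using t \<open>0 \<in> simplexS \<sigma> k\<close> by simp
    next
      case False
      then show ?thesis using * by simp
    qed
    then show ?thesis unfolding p_def by (rule h_P)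
  qed
  define l where "l = affine hull {p 0, p 1}"
  have l: "rational_line l"
    unfolding l_def using inj_p by (intro rational_line_lattice p_lat) (auto dest: injD)
  have p_l: "p t \<in> l" for t
  proof -
    have "f (p t) = f ((1 - real t) *\<^sub>R p 0 + real t *\<^sub>R p 1)"
      unfolding affine by (simp add: p_def fh)
    then have "p t = (1 - real t) *\<^sub>R p 0 + real t *\<^sub>R p 1" using inj_f by (rule injD[rotated])
    then show ?thesis unfolding l_def affine_hull_2 by force
  qed
  have "p ` {0..M} \<subseteq> P \<inter> lattice \<inter> l" using p_lat p_P p_l by auto
  then have "card {0..M} \<le> card (P \<inter> lattice \<inter> l)"
    using finite_lattice_Int[OF P] inj_p by (meson card_inj_on_le finite_Int inj_on_subset subset_UNIV)
  then have "Suc M \<le> card (P \<inter> lattice \<inter> l)" by simp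
  then show "int ((k + 1) * (sylv CARD('n) - 1)) \<le> ld P"
    using ld_ge[OF finite_lattice_Int[OF P] l] unfolding M_def[symmetric] by linarith
  define Q where "Q = convex hull (interior P \<inter> lattice)"
  define pt where "pt t = (\<chi> j. if j = ?s then real t else 1)" for t
  \<comment> \<open>A convex set containing the images of the interior lattice points, hence that of
    their hull; its lattice points are \<open>pt 1\<close> to \<open>pt k\<close>.\<close>
  define B where "B = {y::real^'n. (\<forall>j. j \<noteq> ?s \<longrightarrow> y $ j = 1) \<and> 1 \<le> y $ ?s \<and> y $ ?s \<le> real k}"
  have "convex B"
    unfolding convex_def
  proof (intro ballI allI impI)
    fix x y :: "real^'n" and s t :: real
    assume *: "x \<in> B" "y \<in> B" "0 \<le> s" "0 \<le> t" "s + t = 1"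
    have "s * 1 + t * 1 \<le> s * x $ ?s + t * y $ ?s"
      by (intro add_mono mult_left_mono) (use * in \<open>auto simp: B_def\<close>)
    moreover have "s * x $ ?s + t * y $ ?s \<le> s * real k + t * real k"
      by (intro add_mono mult_left_mono) (use * in \<open>auto simp: B_def\<close>)
    moreover have "s * real k + t * real k = real k"
      using *(5) by (simp add: distrib_right[symmetric])
    ultimately show "s *\<^sub>R x + t *\<^sub>R y \<in> B"
      using * by (simp add: B_def)
  qed
  have f_int: "f ` interior P = interior (simplexS \<sigma> k)"
  proof -
    have "inj g" using inj_f by (auto simp: inj_def f_def)
    have "simplexS \<sigma> k = (+) b ` g ` P" unfolding f(3)[symmetric] f_def by (auto simp: image_image add.commute)
    then have "interior (simplexS \<sigma> k) = (+) b ` g ` interior P"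
      by (simp only: interior_translation interior_injective_linear_image[OF g \<open>inj g\<close>])
    then show ?thesis unfolding f_def by (auto simp: image_image add.commute)
  qed
  have "f ` Q = convex hull (f ` (interior P \<inter> lattice))"
  proof -
    have "f ` X = (+) b ` g ` X" for X by (auto simp: f_def image_image add.commute)
    then show ?thesis unfolding Q_def by (simp only: convex_hull_linear_image[OF g] convex_hull_translation)
  qed
  also have "\<dots> \<subseteq> B"
  proof (rule hull_minimal, rule image_subsetI)
    show "convex B" by fact
    fix x assume x: "x \<in> interior P \<inter> lattice"
    then have "f x \<in> interior (simplexS \<sigma> k)" "f x \<in> lattice" using f_int f(2) by blast+
    from interior_lattice_simplexS[OF d2 \<sigma> this] show "f x \<in> B" by (auto simp: B_def)
  qed
  finally have QB: "f ` Q \<subseteq> B" .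
  have img: "f ` (Q \<inter> lattice) \<subseteq> pt ` {1..k}"
  proof (rule image_subsetI)
    fix x assume "x \<in> Q \<inter> lattice"
    then have y: "f x \<in> B" "f x \<in> lattice" using QB f(2) by blast+
    obtain n where n: "f x $ ?s = of_int n" using y(2) by (auto simp: lattice_def elim: Ints_cases)
    then have "1 \<le> n" "n \<le> int k" using y(1) by (auto simp: B_def) 
    then have "f x = pt (nat n)" "nat n \<in> {1..k}" using y(1) n by (auto simp: pt_def B_def vec_eq_iff)
    then show "f x \<in> pt ` {1..k}" by blast
  qed
  have inj': "inj_on f (Q \<inter> lattice)" using inj_f by (rule inj_on_subset) simp
  have fin: "finite (Q \<inter> lattice)"
    using finite_subset[OF img] inj' by (auto dest: finite_imageD)
  have "card (Q \<inter> lattice) \<le> card (pt ` {1..k})"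
    using inj' img by (rule card_inj_on_le) simp
  also have "card (pt ` {1..k}) \<le> k" using card_image_le[of "{1..k}" pt] by simp
  finally have card_Q: "card (Q \<inter> lattice) \<le> k" .
  obtain l' where "ld Q = int (card (Q \<inter> lattice \<inter> l')) - 1" using ld_attained[OF fin] by blast
  moreover have "card (Q \<inter> lattice \<inter> l') \<le> card (Q \<inter> lattice)" using fin by (intro card_mono) auto
  ultimately show "ld (convex hull (interior P \<inter> lattice)) \<le> int k - 1"
    using card_Q unfolding Q_def by linarith
qed

section \<open>Assembling the bound and the equality case\<close>

text \<open>The segment from \<open>a\<close> to the interior point \<open>x0\<close> can be
  prolonged inside \<open>P\<close> by a factor 1 + e. Expanding its end in the vertices gives
  \<open>x0 - a\<close> coefficients of sum 1 / (1 + e), below 1, as Caratheodory's theorem modulo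
  \<open>u\<close> requires.\<close>

lemma ex_fibred_simplex:
  fixes P :: "(real^'n) set" and K :: int
  assumes P: "polytope P" "\<And>v. v extreme_point_of P \<Longrightarrow> v \<in> lattice"
    and x0: "x0 \<in> interior P" "x0 \<in> lattice"
    and bound: "\<And>g. rational_line g \<Longrightarrow> int (card (interior P \<inter> lattice \<inter> g)) < K"
    and a: "a \<in> lattice" "a \<in> P" and u: "u \<in> lattice" "u \<noteq> 0"
    and L: "0 < L" "a + L *\<^sub>R u \<in> P"
  obtains D where "fibred_simplex P a u L (of_int K) D"
proof -
  define V where "V = {v. v extreme_point_of P}"
  have conv: "convex P" and comp: "compact P"
    using P(1) by (auto simp: polytope_imp_convex polytope_imp_compact)
  have fin: "finite (interior P \<inter> lattice)"
    using finite_lattice_Int[OF bounded_subset[OF polytope_imp_bounded[OF P(1)] interior_subset]] .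
  obtain W where W: "finite W" "P = convex hull W" using P(1) by (auto simp: polytope_def)
  have finV: "finite V"
    unfolding V_def W(2) using W(1) extreme_points_of_convex_hull finite_subset by blast
  have PV: "P = convex hull V"
    unfolding V_def by (rule Krein_Milman_Minkowski[OF comp conv])
  obtain e where e: "0 < e" "x0 + e *\<^sub>R (x0 - a) \<in> P"
  proof -
    obtain r where r: "0 < r" "ball x0 r \<subseteq> P" using x0(1) mem_interior by blast
    define n where "n = norm (x0 - a) + 1"
    define e where "e = r / (2 * n)"
    have n: "0 < n" "norm (x0 - a) \<le> n" by (auto simp: n_def add_nonneg_pos)
    have "e * norm (x0 - a) \<le> e * n"
      using r n by (intro mult_left_mono) (auto simp: e_def)
    also have "\<dots> = r / 2" using n by (simp add: e_def)
    finally have "e * norm (x0 - a) < r" using r by linarith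
    moreover have "0 < e" using r n by (simp add: e_def)
    ultimately have "x0 + e *\<^sub>R (x0 - a) \<in> ball x0 r" by (simp add: dist_norm)
    then show thesis using that r \<open>0 < e\<close> by blast
  qed
  then obtain c where c: "\<And>v. v \<in> V \<Longrightarrow> 0 \<le> c v" "sum c V = 1" "(\<Sum>v\<in>V. c v *\<^sub>R v) = x0 + e *\<^sub>R (x0 - a)"
    unfolding PV convex_hull_finite[OF finV] by blast
  define D0 where "D0 = (\<lambda>v. v - a) ` V"
  define \<beta>0 where "\<beta>0 d = c (a + d) / (1 + e)" for d
  have inj: "inj_on (\<lambda>v. v - a) V" by (auto simp: inj_on_def)
  have sum_\<beta>0: "sum \<beta>0 D0 = 1 / (1 + e)"
    unfolding D0_def sum.reindex[OF inj] by (simp add: \<beta>0_def sum_divide_distrib[symmetric] c(2))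
  have "(\<Sum>d\<in>D0. \<beta>0 d *\<^sub>R d) = (1 / (1 + e)) *\<^sub>R (\<Sum>v\<in>V. c v *\<^sub>R (v - a))"
    unfolding D0_def sum.reindex[OF inj] by (simp add: \<beta>0_def scaleR_sum_right)
  also have "(\<Sum>v\<in>V. c v *\<^sub>R (v - a)) = (x0 + e *\<^sub>R (x0 - a)) - a"
    using c(2,3) by (simp add: scaleR_diff_right sum_subtractf scaleR_sum_left[symmetric])
  also have "\<dots> = (1 + e) *\<^sub>R (x0 - a)"
    by (simp add: algebra_simps)
  finally have y: "x0 - a = (\<Sum>d\<in>D0. \<beta>0 d *\<^sub>R d)" using e by simp
  have "finite D0" "\<And>d. d \<in> D0 \<Longrightarrow> 0 \<le> \<beta>0 d" "sum \<beta>0 D0 < 1"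
    using finV c(1) e sum_\<beta>0 by (auto simp: D0_def \<beta>0_def)
  from caratheodory_modulo_line[OF u(2) this(1) y this(2,3)]
  obtain D \<beta> \<tau> where D: "D \<subseteq> D0" "u \<notin> D" "independent (insert u D)"
    and \<beta>: "\<And>d. d \<in> D \<Longrightarrow> 0 < \<beta> d" "sum \<beta> D < 1" "x0 - a = (\<Sum>d\<in>D. \<beta> d *\<^sub>R d) + \<tau> *\<^sub>R u"
    by blast
  have x0_eq: "a + (\<Sum>d\<in>D. \<beta> d *\<^sub>R d) + \<tau> *\<^sub>R u = x0" using \<beta>(3) by (simp add: algebra_simps)
  have "fibred_simplex P a u L (of_int K) D"
  proof
    show "finite D" using D(1) finV finite_subset unfolding D0_def by blast
    show "D \<subseteq> lattice" using D(1) P(2) a(1) by (auto simp: D0_def V_def intro: lattice_diff)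
    show "a + d \<in> P" if "d \<in> D" for d
      using D(1) that PV hull_inc[of _ V convex] by (force simp: D0_def)
    show "\<exists>\<gamma> \<tau>. (\<forall>d\<in>D. 0 < \<gamma> d) \<and> sum \<gamma> D < 1 \<and> a + (\<Sum>d\<in>D. \<gamma> d *\<^sub>R d) + \<tau> *\<^sub>R u \<in> interior P \<inter> lattice"
      using \<beta>(1,2) x0 by (intro exI[of _ \<beta>] exI[of _ \<tau>]) (auto simp: x0_eq)
    show "l \<le> of_int K \<and> (l = of_int K \<longrightarrow> \<tau> \<in> \<int>)"
      if "z \<in> lattice" "z + \<kappa> *\<^sub>R u \<in> interior P" "z + \<tau> *\<^sub>R u \<in> P" "z + (\<tau> + l) *\<^sub>R u \<in> P" for z \<kappa> \<tau> l
      using fibre_length_le[OF conv fin bound u that] .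
  qed (use conv a u L D in auto)
  then show thesis by (rule that)
qed

text \<open>An edge \<open>d\<close> that comes i-th in the enumeration \<open>v\<close> gets the
  multiplier \<open>sylv i\<close> and the axis \<open>\<sigma> i\<close>; the last axis is left for
  \<open>u\<close>. By \<open>L_eq\<close> and \<open>K_k\<close> the resulting simplex is
  \<open>simplexS \<sigma> k\<close>.\<close>

lemma extremal_imp_unimod_equiv:
  fixes P :: "(real^'n) set" and \<sigma> :: "nat \<Rightarrow> 'n"
  assumes fs: "fibred_simplex P a u L K D"
    and v: "bij_betw v {1..card D} D" and adm: "fibred_simplex.admissible a u D \<beta>"
    and \<beta>: "\<forall>i\<in>{1..card D}. \<beta> (v i) = 1 / real (sylv i)"
    and card_D: "Suc (card D) = CARD('n)"
    and L_eq: "L = K * (real (sylv CARD('n)) - 1)" and K_k: "K = real (k + 1)"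
    and prim: "\<And>c. c *\<^sub>R u \<in> lattice \<Longrightarrow> c \<in> \<int>"
    and \<sigma>: "bij_betw \<sigma> {1..CARD('n)} UNIV"
  shows "unimod_equiv P (simplexS \<sigma> k)"
proof -
  interpret fibred_simplex P a u L K D by fact
  define w where "w = inv_into {1..card D} v"
  have w: "bij_betw w D {1..card D}" unfolding w_def using v by (rule bij_betw_inv_into)
  have vw: "v (w d) = d" if "d \<in> D" for d
    using v that unfolding w_def by (rule bij_betw_inv_into_right)
  have w_in: "w d \<in> {1..card D}" if "d \<in> D" for d using w that by (rule bij_betw_apply)
  define m where "m d = sylv (w d)" for d
  have \<beta>_eq: "\<beta> d = 1 / real (m d)" if "d \<in> D" for d
    using \<beta>[rule_format, OF w_in[OF that]] vw[OF that] by (simp add: m_def)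
  have s: "0 < real (sylv CARD('n)) - 1"
    using sylv_ge2[of "CARD('n)"] card_D by simp
  have "(\<Sum>d\<in>D. 1 / real (m d)) = (\<Sum>i\<in>{1..card D}. 1 / real (sylv i))"
    unfolding m_def by (rule sum.reindex_bij_betw[OF w])
  also have "\<dots> = 1 - 1 / (real (sylv CARD('n)) - 1)"
    unfolding sum_inverse_sylv prod_inverse_sylv card_D ..
  finally have sum_m: "(\<Sum>d\<in>D. 1 / real (m d)) = 1 - 1 / (real (sylv CARD('n)) - 1)" .
  interpret extremal_fibred_simplex P a u L K D m
  proof
    show "0 < m d" if "d \<in> D" for d by (simp add: m_def sylv_pos)
    show "coprime (m d) (m e)" if "d \<in> D" "e \<in> D" "d \<noteq> e" for d e
      unfolding m_def using w_in[OF that(1)] w_in[OF that(2)] vw that by (intro coprime_sylv) (auto, metis)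
    show "(\<Sum>d\<in>D. 1 / real (m d)) < 1" using s by (simp add: sum_m)
    show "(1 - (\<Sum>d\<in>D. 1 / real (m d))) * L = K" using s unfolding sum_m L_eq by simp
    show "\<exists>\<tau>. a + (\<Sum>d\<in>D. (1 / real (m d)) *\<^sub>R d) + \<tau> *\<^sub>R u \<in> lattice"
    proof -
      have "(\<Sum>d\<in>D. (1 / real (m d)) *\<^sub>R d) = (\<Sum>d\<in>D. \<beta> d *\<^sub>R d)"
        by (intro sum.cong) (auto simp: \<beta>_eq)
      then show ?thesis using adm by (simp add: admissible_def)
    qed
    show "card D = CARD('n) - 1" using card_D by simp
  qed (rule prim)
  have \<sigma>_inj: "inj_on \<sigma> {1..CARD('n)}" using \<sigma> by (rule bij_betw_imp_inj_on)
  have sub: "w ` D \<subseteq> {1..CARD('n)}" "CARD('n) \<notin> w ` D" "CARD('n) \<in> {1..CARD('n)}"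
    using w_in card_D by force+
  have "unimod_equiv P (convex hull (insert 0 (insert (L *\<^sub>R axis (\<sigma> CARD('n)) 1)
      ((\<lambda>d. real (m d) *\<^sub>R axis (\<sigma> (w d)) 1) ` D))))"
  proof (rule unimod_equiv_standard)
    show "inj_on (\<lambda>d. \<sigma> (w d)) D"
      using comp_inj_on[OF bij_betw_imp_inj_on[OF w] inj_on_subset[OF \<sigma>_inj sub(1)]] by (simp add: o_def)
    show "\<sigma> CARD('n) \<notin> (\<lambda>d. \<sigma> (w d)) ` D"
    proof
      assume "\<sigma> CARD('n) \<in> (\<lambda>d. \<sigma> (w d)) ` D"
      then obtain d where "d \<in> D" "\<sigma> CARD('n) = \<sigma> (w d)" by blast
      then have "CARD('n) = w d" using inj_onD[OF \<sigma>_inj] sub by blast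
      then show False using sub(2) \<open>d \<in> D\<close> by blast
    qed
  qed
  also have "insert 0 (insert (L *\<^sub>R axis (\<sigma> CARD('n)) 1) ((\<lambda>d. real (m d) *\<^sub>R axis (\<sigma> (w d)) 1) ` D))
      = {0} \<union> {real (sylv i) *\<^sub>R axis (\<sigma> i) 1 | i. i \<in> {1..<CARD('n)}}
          \<union> {real ((k + 1) * (sylv CARD('n) - 1)) *\<^sub>R axis (\<sigma> CARD('n)) 1}"
  proof -
    have "(\<lambda>d. real (m d) *\<^sub>R axis (\<sigma> (w d)) 1) ` D = (\<lambda>i. real (sylv i) *\<^sub>R axis (\<sigma> i) 1) ` (w ` D)"
      by (simp add: m_def image_image)
    also have "w ` D = {1..<CARD('n)}"
      using w card_D by (auto simp: bij_betw_def)
    finally have "(\<lambda>d. real (m d) *\<^sub>R axis (\<sigma> (w d)) 1) ` D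
        = {real (sylv i) *\<^sub>R axis (\<sigma> i) 1 | i. i \<in> {1..<CARD('n)}}"
      by blast
    moreover have "L = real ((k + 1) * (sylv CARD('n) - 1))"
      using s unfolding L_eq K_k of_nat_mult by (simp add: of_nat_diff)
    ultimately show ?thesis by auto
  qed
  finally show ?thesis unfolding simplexS_def .
qed

theorem mainTheorem9:
  fixes P :: "(real^'n) set"
  assumes "CARD('n) \<ge> 2"
    and "polytope P"
    and "\<forall>v. v extreme_point_of P \<longrightarrow> v \<in> lattice"
    and "aff_dim P = int CARD('n)"
    and "convex hull (interior P \<inter> lattice) \<noteq> {}"
  shows "ld P \<le> (ld (convex hull (interior P \<inter> lattice)) + 2) * (int (sylv CARD('n)) - 1)
       \<and> (ld P = (ld (convex hull (interior P \<inter> lattice)) + 2) * (int (sylv CARD('n)) - 1)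
         \<longleftrightarrow> (\<exists>(\<sigma>::nat \<Rightarrow> 'n) k::nat. bij_betw \<sigma> {1..CARD('n)} UNIV
                  \<and> unimod_equiv P (simplexS \<sigma> k)))"
proof -
  define Q where "Q = convex hull (interior P \<inter> lattice)"
  \<comment> \<open>One more than the largest number of lattice points of \<open>Q\<close> on a
    rational line, so every such line carries fewer than \<open>K\<close> interior lattice points of
    \<open>P\<close>.\<close>
  define K where "K = ld Q + 2"
  define N where "N = int (sylv CARD('n)) - 1"
  have N: "0 < N" using sylv_ge2[of "CARD('n)"] assms(1) by (simp add: N_def)
  have bounded: "bounded P" and conv: "convex P"
    using assms(2) by (auto simp: polytope_imp_bounded polytope_imp_convex)
  have "Q \<subseteq> P"
    unfolding Q_def using conv interior_subset by (intro hull_minimal) auto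
  then have finQ: "finite (Q \<inter> lattice)"
    using bounded bounded_subset finite_lattice_Int by blast
  have "interior P \<inter> lattice \<noteq> {}" using assms(5) by (metis convex_hull_empty)
  then obtain x0 where x0: "x0 \<in> interior P" "x0 \<in> lattice" by blast
  have sub: "interior P \<inter> lattice \<subseteq> Q \<inter> lattice" unfolding Q_def using hull_subset[of "interior P \<inter> lattice" convex] by blast
  then have K: "2 \<le> K" using ld_nonneg[OF finQ, of x0] x0 by (auto simp: K_def)
  have bound: "int (card (interior P \<inter> lattice \<inter> g)) < K" if "rational_line g" for g
  proof -
    have "card (interior P \<inter> lattice \<inter> g) \<le> card (Q \<inter> lattice \<inter> g)"
      using finQ sub by (intro card_mono) auto
    then show ?thesis using ld_ge[OF finQ that] unfolding K_def by linarith
  qed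
  obtain \<sigma>0 :: "nat \<Rightarrow> 'n" where \<sigma>0: "bij_betw \<sigma>0 {1..CARD('n)} UNIV"
    using ex_bij_betw_nat_finite_1[of "UNIV :: 'n set"] by auto
  have KN: "0 < K * N" using K N by simp
  have main: "ld P \<le> K * N \<and> (ld P = K * N \<longrightarrow> unimod_equiv P (simplexS \<sigma>0 (nat (K - 1))))"
  proof (cases "1 \<le> ld P")
    case False
    then show ?thesis using KN by linarith
  next
    case True
    obtain a u where au: "a \<in> lattice" "a \<in> P" "u \<in> lattice" "u \<noteq> 0" "a + of_int (ld P) *\<^sub>R u \<in> P"
      and prim: "\<And>c. c *\<^sub>R u \<in> lattice \<Longrightarrow> c \<in> \<int>"
      using longest_segment[OF conv bounded True] by blast
    have L: "0 < real_of_int (ld P)" using True by linarith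
    obtain D where fs: "fibred_simplex P a u (of_int (ld P)) (of_int K) D"
      using ex_fibred_simplex[OF assms(2) _ x0 bound au(1-4) L au(5)] assms(3) by blast
    interpret fibred_simplex P a u "of_int (ld P)" "of_int K" D by (rule fs)
    obtain v \<beta> where v: "bij_betw v {1..card D} D" and adm: "admissible \<beta>"
      and le: "real_of_int (ld P) \<le> of_int K * (real (sylv (Suc (card D))) - 1)"
      and eq: "real_of_int (ld P) = of_int K * (real (sylv (Suc (card D))) - 1)
        \<Longrightarrow> \<forall>i\<in>{1..card D}. \<beta> (v i) = 1 / real (sylv i)"
      using length_bound by blast
    have card_le: "Suc (card D) \<le> CARD('n)"
      using independent_bound[OF indep(2)] indep(1) D(1) by simp
    have mono: "sylv (Suc (card D)) \<le> sylv CARD('n)"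
      using sylv_strict_mono[of "Suc (card D)" "CARD('n)"] card_le by (cases "Suc (card D) = CARD('n)") auto
    have "of_int K * (real (sylv (Suc (card D))) - 1) \<le> of_int K * (real (sylv CARD('n)) - 1)"
      using K mono by (intro mult_left_mono) auto
    with le have "real_of_int (ld P) \<le> real_of_int (K * N)" by (simp add: N_def)
    then have "ld P \<le> K * N" by (simp only: of_int_le_iff)
    moreover have "unimod_equiv P (simplexS \<sigma>0 (nat (K - 1)))" if extremal: "ld P = K * N"
    proof -
      have L_eq: "real_of_int (ld P) = of_int K * (real (sylv CARD('n)) - 1)"
        unfolding extremal by (simp add: N_def)
      then have "of_int K * (real (sylv CARD('n)) - 1) \<le> of_int K * (real (sylv (Suc (card D))) - 1)"
        using le by simp
      \<comment> \<open>Strict growth of the Sylvester sequence forces the simplex to have full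
        dimension modulo \<open>u\<close>.\<close>
      then have "sylv CARD('n) \<le> sylv (Suc (card D))" using K by simp
      then have card_D: "Suc (card D) = CARD('n)"
        using sylv_strict_mono[of "Suc (card D)" "CARD('n)"] card_le by linarith
      show ?thesis
      proof (rule extremal_imp_unimod_equiv[OF fs v adm _ card_D L_eq _ prim \<sigma>0])
        show "\<forall>i\<in>{1..card D}. \<beta> (v i) = 1 / real (sylv i)"
          using eq L_eq unfolding card_D by blast
        show "real_of_int K = real (nat (K - 1) + 1)" using K by simp
      qed
    qed
    ultimately show ?thesis by simp
  qed
  \<comment> \<open>The converse, for every numbering of the axes: \<open>ld (convex hull (interior
    P \<inter> lattice)) \<le> int k - 1\<close> gives K \<le> k + 1, so the long edge of the
    simplex already reaches the upper bound \<open>K * N\<close> from \<open>main\<close>.\<close>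
  have "ld P = K * N" if \<sigma>: "bij_betw \<sigma> {1..CARD('n)} UNIV" and equiv: "unimod_equiv P (simplexS \<sigma> k)"
    for \<sigma> :: "nat \<Rightarrow> 'n" and k
  proof -
    note ld = ld_of_unimod_equiv_simplexS[OF assms(1) \<sigma> bounded equiv]
    have "K * N \<le> (int k + 1) * N"
      using ld(2) N unfolding K_def Q_def by (intro mult_right_mono) auto
    also have "\<dots> = int ((k + 1) * (sylv CARD('n) - 1))"
      using N unfolding N_def of_nat_mult by (simp add: of_nat_diff)
    finally show ?thesis using ld(1) main by linarith
  qed
  then show ?thesis
    using main \<sigma>0 unfolding K_def[symmetric] N_def[symmetric] Q_def[symmetric] by blast
qed

end
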